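(* Let $r>0$, $t\geq 0$ with $t+r<1<p<\frac{n}{r+t}$, and let $p'$ satisfy $\frac1p+\frac1{p'}=1$. If $0\leq\tau\leq\frac{1}{p'}$, there exists $f\in M^{t,\tau}_{r,p}(\mathbb{R}^n)$ such that $f\notin X^{t}_{r,p}(\mathbb{R}^n)$.
   Context: For $s\in\mathbb{R}$ and $1<p<\infty$, $H^{s,p}(\mathbb{R}^n)=\{f\in\mathcal{S}'(\mathbb{R}^n):(I-\Delta)^{s/2}f\in L^p\}$. $X^{t}_{r,p}(\mathbb{R}^{n})$ is the set of $f$ with $\sup_{\|g\|_{H^{t+r,p}}\leq 1}\|fg\|_{H^{t,p}}<\infty$. With $f_{t,Q}=\frac{1}{|Q|}\int_Q (I-\Delta)^{t/2}f(x)\,dx$, for $\tau\geq 0$, $M^{t,\tau}_{r,p}(\mathbb{R}^{n})$ is the set of $f$ for which there is $C$ with $\sup_{|Q|=1}|f_{t,Q}|\leq C$ and $\int_Q|(I-\Delta)^{t/2}f(x)-f_{t,Q}|^p\,dx\leq C(1-\log_2|Q|)^{-p\tau}|Q|^{1-p(r+t)/n}$ for every cube $Q$ with $|Q|\leq 1$. *)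

theory Defs
  imports "HOL-Analysis.Analysis"
begin

text \<open>Bessel kernel G_s on R^n (n = DIM('a)), for s > 0, with Fourier convention
  hat f(xi) = int f(x) e^{-2 pi i x xi} dx, so that hat G_s(xi) = (1 + 4 pi^2 |xi|^2)^{-s/2},
  i.e. G_s * h = (I - Laplacian)^{-s/2} h.\<close>
definition bessel_kernel :: "real \<Rightarrow> 'a::euclidean_space \<Rightarrow> real" where
  "bessel_kernel s x =
     (1 / ((4 * pi) powr (s / 2) * Gamma (s / 2))) *
     (LINT d:{0<..}|lborel. exp (- pi * (norm x)\<^sup>2 / d) * exp (- d / (4 * pi))
                              * d powr ((s - real DIM('a)) / 2 - 1))"

text \<open>bessel_pot s h f :  f = (I - Laplacian)^{-s/2} h, equivalently (I - Laplacian)^{s/2} f = h,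
  for s >= 0 (s = 0: identity; s > 0: absolutely convergent convolution with G_s, a.e.).\<close>
definition bessel_pot :: "real \<Rightarrow> ('a::euclidean_space \<Rightarrow> real) \<Rightarrow> ('a \<Rightarrow> real) \<Rightarrow> bool" where
  "bessel_pot s h f \<longleftrightarrow>
     (if s = 0 then (AE x in lborel. f x = h x)
      else (AE x in lborel. integrable lborel (\<lambda>y. bessel_kernel s (x - y) * h y) \<and>
                             f x = (\<integral>y. bessel_kernel s (x - y) * h y \<partial>lborel)))"

definition H_norm_le :: "real \<Rightarrow> real \<Rightarrow> ('a::euclidean_space \<Rightarrow> real) \<Rightarrow> real \<Rightarrow> bool" where
  "H_norm_le s p g N \<longleftrightarrow>
     (\<exists>k. k \<in> borel_measurable lborel \<and> integrable lborel (\<lambda>x. \<bar>k x\<bar> powr p) \<and>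
          (\<integral>x. \<bar>k x\<bar> powr p \<partial>lborel) powr (1 / p) \<le> N \<and> bessel_pot s k g)"

definition X_space :: "real \<Rightarrow> real \<Rightarrow> real \<Rightarrow> ('a::euclidean_space \<Rightarrow> real) set" where
  "X_space t r p = {f. \<exists>C. \<forall>g. H_norm_le (t + r) p g 1 \<longrightarrow> H_norm_le t p (\<lambda>x. f x * g x) C}"

definition is_cube :: "'a::euclidean_space set \<Rightarrow> bool" where
  "is_cube Q \<longleftrightarrow> (\<exists>a l. l > 0 \<and> Q = cbox a (a + l *\<^sub>R One))"

definition cube_avg :: "('a::euclidean_space \<Rightarrow> real) \<Rightarrow> 'a set \<Rightarrow> real" where
  "cube_avg h Q = (1 / measure lborel Q) * (LINT x:Q|lborel. h x)"

definition M_space :: "real \<Rightarrow> real \<Rightarrow> real \<Rightarrow> real \<Rightarrow> ('a::euclidean_space \<Rightarrow> real) set" where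
  "M_space t \<tau> r p = {f. \<exists>h. h \<in> borel_measurable lborel \<and> bessel_pot t h f \<and>
     (\<forall>Q. is_cube Q \<longrightarrow> set_integrable lborel Q h) \<and>
     (\<exists>C. (\<forall>Q. is_cube Q \<and> measure lborel Q = 1 \<longrightarrow> \<bar>cube_avg h Q\<bar> \<le> C) \<and>
          (\<forall>Q. is_cube Q \<and> measure lborel Q \<le> 1 \<longrightarrow>
              set_integrable lborel Q (\<lambda>x. \<bar>h x - cube_avg h Q\<bar> powr p) \<and>
              (LINT x:Q|lborel. \<bar>h x - cube_avg h Q\<bar> powr p)
                \<le> C * (1 - log 2 (measure lborel Q)) powr (- p * \<tau>)
                    * (measure lborel Q) powr (1 - p * (r + t) / real DIM('a))))}"

end

theory Submission
  imports Defs
begin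

text \<open>Put \<open>\<sigma> = t + r\<close> and let \<open>E\<^sub>k\<close> be the \<open>k\<close>-th stage of a Cantor set in \<open>\<real>\<^sup>n\<close> made of
  \<open>2\<^bsup>nk\<^esup>\<close> cubes of side \<open>l\<^sub>k\<close>, where \<open>l\<^sub>k\<close> is chosen so that each cube carries the mass
  \<open>2\<^bsup>-nk\<^esup>\<close>, equal to \<open>l\<^bsup>n-\<sigma>p\<^esup> (log 1/l)\<^bsup>-(p-1)\<^esup>\<close> at \<open>l = l\<^sub>k\<close> up to constants. This is the
  extreme growth allowed by \<open>M\<close> (for \<open>\<tau> = 1/p'\<close>), but the dust has vanishing \<open>(\<sigma>,p)\<close>-capacity:
  summing over the shells \<open>E\<^sub>j - E\<^bsub>j+1\<^esub>\<close>, \<open>j < k\<close>, one finds \<open>g \<ge> 0\<close> of norm at most 1 in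
  \<open>H\<^bsup>\<sigma>,p\<^esup>\<close> with \<open>g \<ge> c (\<Sum>j<k. 1/j)\<^bsup>1-1/p\<^esup>\<close> on \<open>E\<^sub>k\<close>. Let \<open>f = (I - \<Delta>)\<^bsup>-t/2\<^esup> h\<close>, with \<open>h\<close>
  a weighted sum of normalised indicators of a sparse sequence of shells. All kernels are
  positive, so \<open>f\<close> and \<open>g\<close> can be bounded below on a shell \<open>F\<close>, and the resulting lower bound for
  \<open>\<integral>\<^sub>F f g\<close> contradicts the trace inequality
  \<open>\<integral>\<^sub>F |u| \<le> C l\<^sup>t |F|\<^bsup>1-1/p\<^esup> (1 + \<parallel>u\<parallel>\<^bsub>t,p\<^esub>\<^sup>p)\<close>, valid for \<open>F \<subseteq> E\<^sub>k\<close>, \<open>l = l\<^sub>k\<close>, since \<open>t < \<sigma>\<close>.\<close>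

section \<open>The Bessel kernel\<close>

text \<open>Every admissible \<open>\<tau>\<close> reduces to the endpoint 1/p': the logarithmic
  base in \<open>M_space\<close> is at least 1 on small cubes, so lowering its exponent to -(p-1)
  only strengthens the bound. At the endpoint the whole gain is the divergence of a harmonic sum,
  because \<open>x j\<close> grows linearly in j while the scales decay geometrically. A single
  stage gives only a function whose products are large compared with its \<open>M\<close>-size. One
  fixed function comes from superposing stages k_m: stage k_m enters h^p with coefficient 2^-m, and
  k_m is taken so large that the gain is at least 4^m. The obstacle is logarithmic. In balls of
  radius rho above l_k, the natural bound for the relative density of the dust exceeds
  (l_k/rho)^(sigma p) by a power of a ratio of logarithms. Relaxing sigma to some q < sigma absorbs
  that power, and q > t keeps the dyadic sum in the trace inequality convergent. The inequality |a|
  \<le> m^(1-p) |a|^p + m, with m adapted to the set, plays the part of Hoelder's inequality; the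
  inhomogeneous factor 1 + D comes from it.\<close>

definition bessel_integrand :: "real \<Rightarrow> 'a::euclidean_space \<Rightarrow> real \<Rightarrow> real" where
  "bessel_integrand s x d = exp (- pi * (norm x)\<^sup>2 / d) * exp (- d / (4 * pi))
                              * d powr ((s - real DIM('a)) / 2 - 1)"

lemma bessel_kernel_alt:
  "bessel_kernel s x = (1 / ((4 * pi) powr (s / 2) * Gamma (s / 2))) *
     (LINT d:{0<..}|lborel. bessel_integrand s x d)"
  unfolding bessel_kernel_def bessel_integrand_def ..

lemma bessel_kernel_measurable [measurable]: "bessel_kernel s \<in> borel_measurable borel"
  unfolding bessel_kernel_def set_lebesgue_integral_def by measurable

lemma bessel_integrand_measurable [measurable]: "bessel_integrand s x \<in> borel_measurable borel"
  unfolding bessel_integrand_def by measurable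

lemma bessel_integrand_nonneg: "bessel_integrand s x d \<ge> 0"
  unfolding bessel_integrand_def by simp

lemma bessel_kernel_nonneg:
  assumes "s > 0" shows "bessel_kernel s x \<ge> 0"
  unfolding bessel_kernel_alt set_lebesgue_integral_def
  using assms by (intro mult_nonneg_nonneg integral_nonneg_AE)
    (auto simp: bessel_integrand_nonneg intro!: Gamma_real_pos less_imp_le)

text \<open>The integral is split at d = |x|^2. Below, the Gaussian beats the power of d, by (z/k)^k
  \<le> e^z with z = pi |x|^2 / d. Above, both exponentials are dropped and d^(-k) is integrable at
  infinity because s < n means k > 1. Each piece is a multiple of |x|^(s-n).\<close>

lemma bessel_integrand_nn_integral_le:
  fixes x :: "'a::euclidean_space"
  assumes "s < real DIM('a)" "x \<noteq> 0"
  defines "k \<equiv> 1 + (real DIM('a) - s) / 2"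
  shows "(\<integral>\<^sup>+ d\<in>{0<..}. ennreal (bessel_integrand s x d) \<partial>lborel)
     \<le> ennreal (((k / pi) powr k + 1 / (k - 1)) * norm x powr (s - real DIM('a)))"
proof -
  define a where "a = (norm x)\<^sup>2"
  have a: "a > 0" using assms by (simp add: a_def)
  have k: "k > 1" using assms by (simp add: k_def)
  define C where "C = (k / pi) powr k * a powr (- k)"
  have C: "C \<ge> 0" by (simp add: C_def)
  have J: "bessel_integrand s x d = exp (- pi * a / d) * exp (- d / (4 * pi)) * d powr (- k)" for d
  proof -
    have "(s - real DIM('a)) / 2 - 1 = - k" by (simp add: k_def field_simps)
    thus ?thesis by (simp only: bessel_integrand_def a_def)
  qed
  have small: "exp (- pi * a / d) * d powr (- k) \<le> C" if d: "d > 0" for d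
  proof -
    define z where "z = pi * a / d"
    have z: "z > 0" using a d by (simp add: z_def)
    have "(z / k) powr k \<le> exp (z / k) powr k"
      using z k by (intro powr_mono2 order.trans[OF _ exp_ge_add_one_self[of "z / k"]]) auto
    also have "\<dots> = exp z" using k by (simp add: exp_powr_real)
    finally have "(z / k) powr k \<le> exp z" .
    hence "exp (- z) \<le> 1 / (z / k) powr k"
      using z k by (simp add: exp_minus field_simps)
    also have "\<dots> = (k / z) powr k"
      using z k by (simp add: powr_divide)
    also have "\<dots> = (k / pi) powr k * a powr (-k) * d powr k"
      using a d k by (simp add: z_def powr_divide powr_mult powr_minus field_simps)
    finally have "exp (- z) * d powr (-k) \<le> C * d powr k * d powr (-k)"
      by (intro mult_right_mono) (auto simp: C_def)
    also have "\<dots> = C" using d by (simp add: powr_minus)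
    finally show ?thesis by (simp add: z_def)
  qed
  have le: "ennreal (bessel_integrand s x d) * indicator {0<..} d \<le>
     ennreal C * indicator {0..a} d + indicator {a..} d * ennreal (d powr (- k))" for d
  proof -
    consider "d \<le> 0" | "0 < d" "d \<le> a" | "d > a" by linarith
    thus ?thesis
    proof cases
      case 2
      have "bessel_integrand s x d \<le> exp (- pi * a / d) * 1 * d powr (- k)"
        unfolding J using 2 by (intro mult_right_mono mult_left_mono) auto
      also have "\<dots> \<le> C" using small[of d] 2 by simp
      finally have "ennreal (bessel_integrand s x d) \<le> ennreal C" by (rule ennreal_leI)
      thus ?thesis using 2 by (simp add: indicator_def add_increasing2)
    next
      case 3
      have "bessel_integrand s x d \<le> 1 * 1 * d powr (- k)"
        unfolding J using 3 a by (intro mult_right_mono mult_mono) auto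
      hence "ennreal (bessel_integrand s x d) \<le> ennreal (d powr (- k))" by (intro ennreal_leI) simp
      thus ?thesis using 3 a by (simp add: indicator_def)
    qed auto
  qed
  have "(\<integral>\<^sup>+ d\<in>{0<..}. ennreal (bessel_integrand s x d) \<partial>lborel) \<le>
     (\<integral>\<^sup>+ d. (ennreal C * indicator {0..a} d + indicator {a..} d * ennreal (d powr (- k))) \<partial>lborel)"
    by (intro nn_integral_mono le)
  also have "\<dots> = ennreal C * ennreal a + (\<integral>\<^sup>+ d. indicator {a..} d * ennreal (d powr (- k)) \<partial>lborel)"
    using a by (subst nn_integral_add) (auto simp: nn_integral_cmult_indicator)
  also have "(\<integral>\<^sup>+ d. indicator {a..} d * ennreal (d powr (- k)) \<partial>lborel) =
     ennreal (- (a powr (- k + 1)) / (- k + 1))"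
    by (rule trans[OF _ nn_integral_has_integral_lebesgue[OF _ has_integral_powr_to_inf[of "-k" a]]])
      (use a k in \<open>auto simp: ennreal_mult' ennreal_indicator intro!: nn_integral_cong\<close>)
  also have "ennreal C * ennreal a + ennreal (- (a powr (- k + 1)) / (- k + 1)) =
     ennreal (C * a + a powr (1 - k) / (k - 1))"
  proof -
    have e: "- (a powr (- k + 1)) / (- k + 1) = a powr (1 - k) / (k - 1)"
      using k by (simp add: field_simps)
    have "a powr (1 - k) / (k - 1) \<ge> 0" using k by simp
    with C a show ?thesis unfolding e by (simp add: ennreal_mult')
  qed
  also have "C * a = (k / pi) powr k * a powr (1 - k)"
    using a by (simp add: C_def powr_diff powr_minus field_simps)
  also have "a powr (1 - k) = norm x powr (s - real DIM('a))"
  proof -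
    have "2 * (1 - k) = s - real DIM('a)" by (simp add: k_def field_simps)
    moreover have "a powr (1 - k) = norm x powr (2 * (1 - k))"
      using assms(2) by (simp add: a_def powr_powr flip: powr_numeral)
    ultimately show ?thesis by simp
  qed
  finally show ?thesis by (simp add: field_simps)
qed

lemma bessel_integrand_integrable:
  fixes x :: "'a::euclidean_space"
  assumes "s < real DIM('a)" "x \<noteq> 0"
  shows "set_integrable lborel {0<..} (bessel_integrand s x)"
  unfolding set_integrable_def
proof (rule integrableI_nonneg)
  have "(\<integral>\<^sup>+ d. ennreal (indicator {0<..} d *\<^sub>R bessel_integrand s x d) \<partial>lborel)
     = (\<integral>\<^sup>+ d\<in>{0<..}. ennreal (bessel_integrand s x d) \<partial>lborel)"
    by (intro nn_integral_cong) (auto simp: indicator_def)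
  also have "\<dots> < \<infinity>"
    using bessel_integrand_nn_integral_le[OF assms] by (rule le_less_trans) simp
  finally show "(\<integral>\<^sup>+ d. ennreal (indicator {0<..} d *\<^sub>R bessel_integrand s x d) \<partial>lborel) < \<infinity>" .
qed (auto simp: bessel_integrand_nonneg)

lemma bessel_kernel_upper:
  fixes s :: real
  assumes "0 < s" "s < real DIM('a)"
  obtains C where "C > 0"
    "\<And>x :: 'a::euclidean_space. x \<noteq> 0 \<Longrightarrow> bessel_kernel s x \<le> C * norm x powr (s - real DIM('a))"
proof -
  define k where "k = 1 + (real DIM('a) - s) / 2"
  define A where "A = 1 / ((4 * pi) powr (s / 2) * Gamma (s / 2))"
  define B where "B = (k / pi) powr k + 1 / (k - 1)"
  have A: "A > 0" using assms by (auto simp: A_def Gamma_real_pos)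
  have k: "k > 1" using assms by (simp add: k_def)
  hence B: "B > 0" unfolding B_def by (intro add_pos_pos) auto
  show ?thesis
  proof (rule that[of "A * B"])
    fix x :: 'a assume x: "x \<noteq> 0"
    have "(LINT d:{0<..}|lborel. bessel_integrand s x d) =
       enn2real (\<integral>\<^sup>+ d\<in>{0<..}. ennreal (bessel_integrand s x d) \<partial>lborel)"
      unfolding set_lebesgue_integral_def
      by (subst integral_eq_nn_integral)
         (auto simp: bessel_integrand_nonneg indicator_def intro!: arg_cong[where f = enn2real] nn_integral_cong)
    also have "\<dots> \<le> B * norm x powr (s - real DIM('a))"
      using bessel_integrand_nn_integral_le[OF assms(2) x] B
      by (intro enn2real_leI) (auto simp: B_def k_def)
    finally show "bessel_kernel s x \<le> A * B * norm x powr (s - real DIM('a))"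
      using A unfolding bessel_kernel_alt A_def[symmetric] mult.assoc by (intro mult_left_mono) auto
  qed (use A B in auto)
qed

text \<open>The range d in [r^2, 2 r^2] alone is enough: there the Gaussian is at least exp(-pi), d
  is comparable to r^2, and \<open>R\<close> controls exp(-d/(4 pi)). Evaluating at \<open>r\<close>
  instead of the norm of \<open>x\<close> gives one value valid on a whole punctured ball.\<close>

lemma bessel_kernel_lower:
  fixes s R :: real
  assumes "0 < s" "s < real DIM('a)" "R > 0"
  obtains c where "c > 0"
    "\<And>(x :: 'a::euclidean_space) r. x \<noteq> 0 \<Longrightarrow> norm x \<le> r \<Longrightarrow> r \<le> R \<Longrightarrow>
        c * r powr (s - real DIM('a)) \<le> bessel_kernel s x"
proof -
  define m where "m = (real DIM('a) - s) / 2 + 1"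
  define A where "A = 1 / ((4 * pi) powr (s / 2) * Gamma (s / 2))"
  define B where "B = exp (- pi) * exp (- (2 * R\<^sup>2) / (4 * pi)) * 2 powr (- m)"
  have A: "A > 0" using assms by (auto simp: A_def Gamma_real_pos)
  have B: "B > 0" unfolding B_def by auto
  have m: "m > 0" unfolding m_def using assms by (intro add_nonneg_pos) auto
  show ?thesis
  proof (rule that[of "A * B"])
    fix x :: 'a and r assume x: "x \<noteq> 0" "norm x \<le> r" "r \<le> R"
    have r: "r > 0" using x by (meson dual_order.strict_trans1 zero_less_norm_iff)
    have le: "B * (r\<^sup>2) powr (- m) \<le> bessel_integrand s x d" if d: "d \<in> {r\<^sup>2..2 * r\<^sup>2}" for d
    proof -
      have d0: "d > 0" using d r by (smt (verit) atLeastAtMost_iff zero_less_power)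
      have "(norm x)\<^sup>2 \<le> r\<^sup>2" "r\<^sup>2 \<le> R\<^sup>2" using x r by (auto intro!: power_mono)
      hence "(norm x)\<^sup>2 \<le> d" "d \<le> 2 * R\<^sup>2" using d by auto
      hence "exp (- pi) \<le> exp (- pi * (norm x)\<^sup>2 / d)"
        "exp (- (2 * R\<^sup>2) / (4 * pi)) \<le> exp (- d / (4 * pi))"
        using d0 by (auto simp: field_simps)
      moreover have "2 powr (- m) * (r\<^sup>2) powr (- m) \<le> d powr ((s - real DIM('a)) / 2 - 1)"
      proof -
        have "2 powr (- m) * (r\<^sup>2) powr (- m) = (2 * r\<^sup>2) powr (- m)" by (simp add: powr_mult)
        also have "\<dots> \<le> d powr (- m)" using d d0 m by (intro powr_mono2') auto
        finally have "2 powr (- m) * (r\<^sup>2) powr (- m) \<le> d powr (- m)" .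
        moreover have "- m = (s - real DIM('a)) / 2 - 1" by (simp add: m_def field_simps)
        ultimately show ?thesis by simp
      qed
      ultimately show ?thesis
        unfolding B_def bessel_integrand_def mult.assoc[of _ "2 powr (- m)"] by (intro mult_mono) auto
    qed
    have "B * (r\<^sup>2) powr (- m) * r\<^sup>2 = (LINT d:{r\<^sup>2..2 * r\<^sup>2}|lborel. B * (r\<^sup>2) powr (- m))"
      by (simp add: set_lebesgue_integral_def)
    also have "\<dots> \<le> (LINT d:{0<..}|lborel. bessel_integrand s x d)"
      unfolding set_lebesgue_integral_def
    proof (rule integral_mono)
      show "integrable lborel (\<lambda>d. indicator {0<..} d *\<^sub>R bessel_integrand s x d)"
        using bessel_integrand_integrable[OF assms(2) x(1)] by (simp add: set_integrable_def)
      show "indicator {r\<^sup>2..2 * r\<^sup>2} d *\<^sub>R (B * r\<^sup>2 powr - m) \<le> indicator {0<..} d *\<^sub>R bessel_integrand s x d" for d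
        using le[of d] r bessel_integrand_nonneg[of s x d]
        by (auto simp: indicator_def not_less zero_less_power dest: order.strict_trans1[of "r^2"])
           (smt (verit) zero_less_power)
    qed auto
    also have "B * (r\<^sup>2) powr (- m) * r\<^sup>2 = B * r powr (s - real DIM('a))"
    proof -
      have "(r\<^sup>2) powr (- m) * r\<^sup>2 = r powr (2 * (-m) + 2)"
        using r unfolding powr_add by (simp add: powr_powr flip: powr_numeral)
      also have "2 * (- m) + 2 = s - real DIM('a)" by (simp add: m_def field_simps)
      finally show ?thesis by simp
    qed
    finally show "A * B * r powr (s - real DIM('a)) \<le> bessel_kernel s x"
      using A unfolding bessel_kernel_alt A_def[symmetric] mult.assoc by (intro mult_left_mono) auto
  qed (use A B in auto)
qed

section \<open>A trace inequality for Riesz potentials\<close>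

text \<open>Either |a| \<le> m, or |a|^(p-1) exceeds m^(p-1). The threshold \<open>m\<close> is
  free, and after integration it is chosen so that the two terms balance.\<close>

lemma abs_le_young:
  fixes a m p :: real
  assumes "m > 0" "p > 1"
  shows "\<bar>a\<bar> \<le> m powr (1 - p) * \<bar>a\<bar> powr p + m"
proof (cases "\<bar>a\<bar> \<le> m")
  case False
  hence "m powr (p - 1) \<le> \<bar>a\<bar> powr (p - 1)" using assms by (intro powr_mono2) auto
  hence "m powr (1 - p) * m powr (p - 1) * \<bar>a\<bar> \<le> m powr (1 - p) * \<bar>a\<bar> powr (p - 1) * \<bar>a\<bar>"
    by (intro mult_right_mono mult_left_mono) auto
  moreover have "m powr (1 - p) * m powr (p - 1) = 1" using assms by (simp flip: powr_add)
  moreover have "\<bar>a\<bar> powr (p - 1) * \<bar>a\<bar> = \<bar>a\<bar> powr p"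
    using False assms by (simp add: powr_diff)
  ultimately show ?thesis using assms by (simp add: mult.assoc)
qed (simp add: add_increasing)

text \<open>After the pointwise Young bound, Fubini turns the integral over \<open>F\<close> into |F
  \<inter> B(y,\<rho>)| integrated against |k|^p, where \<open>ball\<close> applies. Up to the
  factor \<open>M\<close>, \<mu>^p bounds the relative density of \<open>F\<close> in balls of
  radius \<rho>; its p-th root is what survives.\<close>

lemma layer_bound:
  fixes F :: "'a::euclidean_space set" and k :: "'a \<Rightarrow> real" and p M D \<mu> \<rho> :: real
  assumes [measurable]: "F \<in> sets borel" "k \<in> borel_measurable borel"
    and F: "emeasure lborel F < \<infinity>" "measure lborel F > 0"
    and p: "p > 1" and M: "M \<ge> 0" and D: "D \<ge> 0" "(\<integral>\<^sup>+y. ennreal (\<bar>k y\<bar> powr p) \<partial>lborel) \<le> ennreal D"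
    and \<rho>: "\<rho> > 0" and \<mu>: "\<mu> > 0"
    and ball: "\<And>y. emeasure lborel (F \<inter> cball y \<rho>) \<le> ennreal (M * \<rho> ^ DIM('a) * \<mu> powr p)"
  shows "(\<integral>\<^sup>+x\<in>F. (\<integral>\<^sup>+y. indicator {..\<rho>} (norm (x - y)) * ennreal \<bar>k y\<bar> \<partial>lborel) \<partial>lborel)
    \<le> ennreal ((M + unit_ball_vol DIM('a)) * (1 + D) * (\<rho> ^ DIM('a) * \<mu> * measure lborel F powr (1 - 1 / p)))"
proof -
  define V where "V = measure lborel F"
  \<comment> \<open>this threshold balances the two terms of \<open>|k| \<le> m\<^bsup>1-p\<^esup> |k|\<^sup>p + m\<close>\<close>
  define m where "m = V powr (- 1 / p) * \<mu>"
  define U where "U = unit_ball_vol (real DIM('a))"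
  have U: "U \<ge> 0" by (simp add: U_def)
  have V: "V > 0" "emeasure lborel F = ennreal V"
    using F by (auto simp: V_def emeasure_eq_ennreal_measure)
  have m: "m > 0" using V \<mu> by (simp add: m_def)
  have ind1: "(\<integral>\<^sup>+y. indicator {..\<rho>} (norm (x - y)) \<partial>lborel) = ennreal (U * \<rho> ^ DIM('a))" for x :: 'a
  proof -
    have "(\<integral>\<^sup>+y. indicator {..\<rho>} (norm (x - y)) \<partial>lborel) = (\<integral>\<^sup>+y. indicator (cball x \<rho>) y \<partial>lborel)"
      by (intro nn_integral_cong) (auto simp: indicator_def dist_norm)
    thus ?thesis using \<rho> by (simp add: emeasure_cball U_def)
  qed
  have ind2: "(\<integral>\<^sup>+x. indicator F x * indicator {..\<rho>} (norm (x - y)) \<partial>lborel) = emeasure lborel (F \<inter> cball y \<rho>)" for y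
  proof -
    have "(\<integral>\<^sup>+x. indicator F x * indicator {..\<rho>} (norm (x - y)) \<partial>lborel) =
      (\<integral>\<^sup>+x. indicator (F \<inter> cball y \<rho>) x \<partial>lborel)"
      by (intro nn_integral_cong) (auto simp: indicator_def dist_norm norm_minus_commute)
    thus ?thesis by simp
  qed
  have "(\<integral>\<^sup>+x. (\<integral>\<^sup>+y. indicator F x * indicator {..\<rho>} (norm (x - y)) *
         ennreal (\<bar>k y\<bar> powr p) \<partial>lborel) \<partial>lborel) =
     (\<integral>\<^sup>+y. (\<integral>\<^sup>+x. indicator F x * indicator {..\<rho>} (norm (x - y)) *
         ennreal (\<bar>k y\<bar> powr p) \<partial>lborel) \<partial>lborel)"
    by (rule lborel_pair.Fubini') measurable
  also have "\<dots> = (\<integral>\<^sup>+y. emeasure lborel (F \<inter> cball y \<rho>) * ennreal (\<bar>k y\<bar> powr p) \<partial>lborel)"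
    by (subst nn_integral_multc) (auto simp: ind2)
  also have "\<dots> \<le> (\<integral>\<^sup>+y. ennreal (M * \<rho> ^ DIM('a) * \<mu> powr p) * ennreal (\<bar>k y\<bar> powr p) \<partial>lborel)"
    by (intro nn_integral_mono mult_right_mono ball) auto
  also have "\<dots> \<le> ennreal (M * \<rho> ^ DIM('a) * \<mu> powr p) * ennreal D"
    by (subst nn_integral_cmult) (auto intro!: mult_left_mono D)
  finally have swap: "(\<integral>\<^sup>+x. (\<integral>\<^sup>+y. indicator F x * indicator {..\<rho>} (norm (x - y)) *
         ennreal (\<bar>k y\<bar> powr p) \<partial>lborel) \<partial>lborel) \<le> ennreal (M * \<rho> ^ DIM('a) * \<mu> powr p) * ennreal D" .
  have "(\<integral>\<^sup>+x\<in>F. (\<integral>\<^sup>+y. indicator {..\<rho>} (norm (x - y)) * ennreal \<bar>k y\<bar> \<partial>lborel) \<partial>lborel)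
    \<le> (\<integral>\<^sup>+x\<in>F. (\<integral>\<^sup>+y. indicator {..\<rho>} (norm (x - y)) *
         (ennreal (m powr (1 - p)) * ennreal (\<bar>k y\<bar> powr p) + ennreal m) \<partial>lborel) \<partial>lborel)"
    using abs_le_young[OF m p] m
    by (intro nn_integral_mono mult_right_mono mult_left_mono)
       (auto simp flip: ennreal_mult ennreal_plus intro!: ennreal_leI)
  also have "\<dots> = (\<integral>\<^sup>+x\<in>F. (ennreal (m powr (1 - p)) * (\<integral>\<^sup>+y. indicator {..\<rho>} (norm (x - y)) *
         ennreal (\<bar>k y\<bar> powr p) \<partial>lborel) + ennreal m * ennreal (U * \<rho> ^ DIM('a))) \<partial>lborel)"
  proof (intro nn_integral_cong arg_cong2[where f = "(*)"] refl)
    fix x :: 'a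
    have "(\<integral>\<^sup>+y. indicator {..\<rho>} (norm (x - y)) *
         (ennreal (m powr (1 - p)) * ennreal (\<bar>k y\<bar> powr p) + ennreal m) \<partial>lborel) =
       (\<integral>\<^sup>+y. ennreal (m powr (1 - p)) * (indicator {..\<rho>} (norm (x - y)) * ennreal (\<bar>k y\<bar> powr p)) +
         ennreal m * indicator {..\<rho>} (norm (x - y)) \<partial>lborel)"
      by (intro nn_integral_cong) (simp add: distrib_left mult_ac)
    also have "\<dots> = ennreal (m powr (1 - p)) * (\<integral>\<^sup>+y. indicator {..\<rho>} (norm (x - y)) *
         ennreal (\<bar>k y\<bar> powr p) \<partial>lborel) + ennreal m * ennreal (U * \<rho> ^ DIM('a))"
      by (subst nn_integral_add) (auto simp: nn_integral_cmult ind1)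
    finally show "(\<integral>\<^sup>+y. indicator {..\<rho>} (norm (x - y)) *
         (ennreal (m powr (1 - p)) * ennreal (\<bar>k y\<bar> powr p) + ennreal m) \<partial>lborel) = \<dots>" .
  qed
  also have "\<dots> = ennreal (m powr (1 - p)) * (\<integral>\<^sup>+x. (\<integral>\<^sup>+y. indicator F x * indicator {..\<rho>} (norm (x - y)) *
         ennreal (\<bar>k y\<bar> powr p) \<partial>lborel) \<partial>lborel) + ennreal m * ennreal (U * \<rho> ^ DIM('a)) * ennreal V"
    by (simp add: distrib_right nn_integral_add nn_integral_cmult mult.assoc nn_integral_cmult_indicator V(2))
       (simp add: nn_integral_cmult[symmetric] mult_ac)
  also have "\<dots> \<le> ennreal (m powr (1 - p)) * (ennreal (M * \<rho> ^ DIM('a) * \<mu> powr p) * ennreal D) +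
      ennreal m * ennreal (U * \<rho> ^ DIM('a)) * ennreal V"
    by (intro add_right_mono mult_left_mono swap) auto
  also have "ennreal (m powr (1 - p)) * (ennreal (M * \<rho> ^ DIM('a) * \<mu> powr p) * ennreal D) +
      ennreal m * ennreal (U * \<rho> ^ DIM('a)) * ennreal V =
     ennreal (m powr (1 - p) * (M * \<rho> ^ DIM('a) * \<mu> powr p * D) + m * (U * \<rho> ^ DIM('a)) * V)"
    using m U \<rho> V M D by (simp add: ennreal_mult ennreal_plus)
  also have "m powr (1 - p) * (M * \<rho> ^ DIM('a) * \<mu> powr p * D) = M * D * (\<rho> ^ DIM('a) * \<mu> * V powr (1 - 1 / p))"
  proof -
    have e: "- 1 / p * (1 - p) = 1 - 1 / p" using p by (simp add: field_simps)
    have "m powr (1 - p) = V powr (1 - 1 / p) * \<mu> powr (1 - p)"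
      unfolding m_def using V \<mu> by (simp only: powr_mult powr_powr e)
    moreover have "\<mu> powr (1 - p) * \<mu> powr p = \<mu>"
      using \<mu> by (simp flip: powr_add)
    ultimately show ?thesis by (simp add: mult_ac) 
  qed
  also have "m * (U * \<rho> ^ DIM('a)) * V = U * (\<rho> ^ DIM('a) * \<mu> * V powr (1 - 1 / p))"
  proof -
    have "V powr (1 - 1 / p) = V * V powr (- 1 / p)" 
      using V powr_add[of V 1 "- 1 / p"] by simp
    thus ?thesis by (simp add: m_def mult_ac)
  qed
  also have "M * D * (\<rho> ^ DIM('a) * \<mu> * V powr (1 - 1 / p)) + U * (\<rho> ^ DIM('a) * \<mu> * V powr (1 - 1 / p))
     = (M * D + U) * (\<rho> ^ DIM('a) * \<mu> * V powr (1 - 1 / p))" by (simp add: algebra_simps)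
  finally have "(\<integral>\<^sup>+x\<in>F. (\<integral>\<^sup>+y. indicator {..\<rho>} (norm (x - y)) * ennreal \<bar>k y\<bar> \<partial>lborel) \<partial>lborel)
    \<le> ennreal ((M * D + U) * (\<rho> ^ DIM('a) * \<mu> * V powr (1 - 1 / p)))" .
  \<comment> \<open>Weakened to a product, so that the geometric constant separates from the
    dependence on \<open>k\<close>.\<close>
  also have "(M * D + U) * (\<rho> ^ DIM('a) * \<mu> * V powr (1 - 1 / p)) \<le> (M + U) * (1 + D) * (\<rho> ^ DIM('a) * \<mu> * V powr (1 - 1 / p))"
    using M U D \<mu> \<rho> by (intro mult_right_mono) (auto simp: algebra_simps)
  finally show ?thesis unfolding U_def V_def by (simp add: ennreal_leI)
qed

text \<open>A single index runs in both directions from \<open>l\<close>: the first term covers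
  distances below \<open>l\<close>, the second those from \<open>l\<close> upward. Using balls in
  place of annuli only enlarges the sum and makes each term an instance of
  \<open>layer_bound\<close>.\<close>

lemma dyadic_decomposition:
  fixes a l e :: real
  assumes "a > 0" "l > 0" "e \<ge> 0"
  shows "ennreal (a powr - e) \<le> (\<Sum>m. ennreal ((l * 2 powr (- real m - 1)) powr - e) * indicator {..l * 2 powr (- real m)} a
      + ennreal ((l * 2 powr real m) powr - e) * indicator {..l * 2 powr (real m + 1)} a)" (is "_ \<le> suminf ?f")
proof -
  define j where "j = \<lfloor>log 2 (a / l)\<rfloor>"
  have al: "a = l * 2 powr (log 2 (a / l))" using assms by (simp add: powr_log_cancel)
  have lo: "l * 2 powr real_of_int j \<le> a"
  proof -
    have "l * 2 powr real_of_int j \<le> l * 2 powr (log 2 (a / l))"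
      using assms by (intro mult_left_mono powr_mono) (auto simp: j_def)
    thus ?thesis using al by simp
  qed
  have hi: "a \<le> l * 2 powr (real_of_int j + 1)"
  proof -
    have "l * 2 powr (log 2 (a / l)) \<le> l * 2 powr (real_of_int j + 1)"
      using assms unfolding j_def by (intro mult_left_mono powr_mono) linarith+
    thus ?thesis using al by simp
  qed
  have "\<exists>m. ennreal (a powr - e) \<le> ?f m"
  proof (cases "j \<ge> 0")
    case True
    hence m: "real (nat j) = real_of_int j" by simp
    have "a powr - e \<le> (l * 2 powr real (nat j)) powr - e"
      unfolding m using assms lo by (intro powr_mono2') auto
    hence "ennreal (a powr - e) \<le> ?f (nat j)"
      using hi unfolding m by (intro add_increasing) (auto simp: indicator_def intro!: ennreal_leI)
    thus ?thesis ..
  next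
    case False
    hence m: "- real (nat (- j - 1)) - 1 = real_of_int j" "- real (nat (- j - 1)) = real_of_int j + 1" by auto
    have "a powr - e \<le> (l * 2 powr (- real (nat (- j - 1)) - 1)) powr - e"
      unfolding m using assms lo by (intro powr_mono2') auto
    hence "ennreal (a powr - e) \<le> ?f (nat (- j - 1))"
      using hi unfolding m by (intro add_increasing2) (auto simp: indicator_def intro!: ennreal_leI)
    thus ?thesis ..
  qed
  then obtain m where "ennreal (a powr - e) \<le> ?f m" ..
  also have "?f m = sum ?f {m}" by simp
  also have "\<dots> \<le> suminf ?f" by (intro sum_le_suminf) auto
  finally show ?thesis .
qed

text \<open>The two geometric series belong to the dyadic scales below and above \<open>l\<close>;
  they converge for t > 0 and for t < q respectively. Fixing the constant by a formula shows that it
  depends neither on the set, nor on \<open>l\<close>, nor on the function, so later bounds are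
  uniform in the Cantor stage.\<close>

definition riesz_trace_const :: "real \<Rightarrow> real \<Rightarrow> real \<Rightarrow> real \<Rightarrow> real" where
  "riesz_trace_const n t q M = (M + unit_ball_vol n) *
     (\<Sum>m. 2 powr (n - t) * (2 powr - t) ^ m + 2 powr (n - q) * (2 powr (t - q)) ^ m)"

text \<open>Hypothesis \<open>ball\<close> lets \<open>F\<close> look n-dimensional up to scale
  \<open>l\<close> and demands relative density at most M (l/\<rho>)^(qp) up to normalisation beyond
  it. A dyadic scale \<rho> then contributes about \<rho>^t min(1, (l/\<rho>)^q), which peaks at
  \<rho> = l with value l^t and decays geometrically on both sides.\<close>

lemma riesz_trace:
  fixes t q p M l D :: real and F :: "'a::euclidean_space set" and k :: "'a \<Rightarrow> real"
  assumes t: "0 < t" "t < q" "t < real DIM('a)" and p: "1 < p" and M: "M \<ge> 0"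
    and F[measurable]: "F \<in> sets borel" and F': "emeasure lborel F < \<infinity>" "measure lborel F > 0" and l: "l > 0"
    and ball: "\<And>y \<rho>. \<rho> > 0 \<Longrightarrow> emeasure lborel (F \<inter> cball y \<rho>) \<le> ennreal (M * \<rho> ^ DIM('a) * (min 1 ((l / \<rho>) powr q)) powr p)"
    and k[measurable]: "k \<in> borel_measurable borel" and D: "D \<ge> 0" "(\<integral>\<^sup>+y. ennreal (\<bar>k y\<bar> powr p) \<partial>lborel) \<le> ennreal D"
  shows "(\<integral>\<^sup>+x\<in>F. (\<integral>\<^sup>+y. ennreal (norm (x - y) powr (t - real DIM('a))) * ennreal \<bar>k y\<bar> \<partial>lborel) \<partial>lborel)
        \<le> ennreal (riesz_trace_const (real DIM('a)) t q M * (1 + D) * (l powr t * measure lborel F powr (1 - 1 / p)))"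
proof -
  define n where "n = real DIM('a)"
  define U where "U = unit_ball_vol n"
  have U: "U \<ge> 0" by (simp add: U_def n_def)
  define A where "A m = 2 powr (n - t) * (2 powr - t) ^ m" for m :: nat
  define B where "B m = 2 powr (n - q) * (2 powr (t - q)) ^ m" for m :: nat
  have AB: "summable A" "summable B"
    unfolding A_def B_def using t powr_less_mono[of "- t" 0 2] powr_less_mono[of "t - q" 0 2]
    by (auto intro!: summable_mult summable_geometric)
  have AB0: "A m \<ge> 0" "B m \<ge> 0" for m by (auto simp: A_def B_def)
  define C where "C = (M + U) * (\<Sum>m. A m + B m)"
  have C: "C = riesz_trace_const (real DIM('a)) t q M"
    by (simp add: C_def A_def B_def U_def n_def riesz_trace_const_def)
  define W where "W = measure lborel F powr (1 - 1 / p)"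
  have W: "W \<ge> 0" by (simp add: W_def)
  define I where "I \<rho> = (\<integral>\<^sup>+x\<in>F. (\<integral>\<^sup>+y. indicator {..\<rho>} (norm (x - y)) * ennreal \<bar>k y\<bar> \<partial>lborel) \<partial>lborel)" for \<rho>
  have I: "I \<rho> \<le> ennreal ((M + U) * (1 + D) * (\<rho> powr n * min 1 ((l / \<rho>) powr q) * W))" if "\<rho> > 0" for \<rho>
    unfolding I_def U_def W_def using layer_bound[OF F k F' p M D that _ ball] that l
    by (simp add: n_def powr_realpow)
  define a where "a m = (l * 2 powr (- real m - 1)) powr - (n - t)" for m :: nat
  define b where "b m = (l * 2 powr real m) powr - (n - t)" for m :: nat
  define r where "r m = l * 2 powr (- real m)" for m :: nat
  define r' where "r' m = l * 2 powr (real m + 1)" for m :: nat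
  have r: "r m > 0" "r' m > 0" for m using l by (auto simp: r_def r'_def)
  have "(\<integral>\<^sup>+x\<in>F. (\<integral>\<^sup>+y. ennreal (norm (x - y) powr (t - n)) * ennreal \<bar>k y\<bar> \<partial>lborel) \<partial>lborel)
   \<le> (\<integral>\<^sup>+x\<in>F. (\<integral>\<^sup>+y. (\<Sum>m. ennreal (a m) * indicator {..r m} (norm (x - y)) + ennreal (b m) * indicator {..r' m} (norm (x - y)))
         * ennreal \<bar>k y\<bar> \<partial>lborel) \<partial>lborel)"
  proof (intro nn_integral_mono mult_right_mono)
    fix x y :: 'a
    show "ennreal (norm (x - y) powr (t - n)) \<le>
      (\<Sum>m. ennreal (a m) * indicator {..r m} (norm (x - y)) + ennreal (b m) * indicator {..r' m} (norm (x - y)))"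
    \<comment> \<open>On the diagonal \<open>0 powr\<close> evaluates to 0, so the claim is trivial
      there.\<close>
    proof (cases "x = y")
      case False
      thus ?thesis using dyadic_decomposition[of "norm (x - y)" l "n - t"] l t
        by (simp add: a_def b_def r_def r'_def n_def)
    qed simp
  qed auto
  also have "\<dots> = (\<integral>\<^sup>+x. (\<integral>\<^sup>+y. (\<Sum>m. ennreal (a m) * (indicator {..r m} (norm (x - y)) * ennreal \<bar>k y\<bar> * indicator F x) +
       ennreal (b m) * (indicator {..r' m} (norm (x - y)) * ennreal \<bar>k y\<bar> * indicator F x))
          \<partial>lborel) \<partial>lborel)"
  proof (rule nn_integral_cong)
    fix x :: 'a
    show "(\<integral>\<^sup>+y. (\<Sum>m. ennreal (a m) * indicator {..r m} (norm (x - y)) + ennreal (b m) * indicator {..r' m} (norm (x - y)))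
         * ennreal \<bar>k y\<bar> \<partial>lborel) * indicator F x = (\<integral>\<^sup>+y. (\<Sum>m. ennreal (a m) * (indicator {..r m} (norm (x - y)) * ennreal \<bar>k y\<bar> * indicator F x) +
       ennreal (b m) * (indicator {..r' m} (norm (x - y)) * ennreal \<bar>k y\<bar> * indicator F x)) \<partial>lborel)"
      by (cases "x \<in> F") (auto intro!: nn_integral_cong simp: distrib_right mult.assoc simp flip: ennreal_suminf_multc)
  qed
  also have "\<dots> = (\<Sum>m. ennreal (a m) * I (r m) + ennreal (b m) * I (r' m))"
    unfolding I_def
    by (simp add: nn_integral_suminf nn_integral_add nn_integral_cmult flip: nn_integral_multc)
  also have "\<dots> \<le> (\<Sum>m. ennreal ((M + U) * (1 + D) * (l powr t * W) * (A m + B m)))"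
  proof (intro suminf_le summableI)
    fix m
    have nt: "l powr - (n - t) * l powr n = l powr t" using l by (simp flip: powr_add)
    have p2: "(2 powr x) ^ m = 2 powr (x * real m)" for x :: real
      by (simp add: powr_powr flip: powr_realpow)
    have l1: "a m * (r m powr n) = l powr t * A m"
    proof -
      have "a m * (r m powr n) = (l powr - (n - t) * l powr n) * (2 powr ((- real m - 1) * - (n - t)) * 2 powr (- real m * n))"
        using l by (simp add: a_def r_def powr_mult powr_powr)
      also have "2 powr ((- real m - 1) * - (n - t)) * 2 powr (- real m * n) = A m"
        by (simp add: A_def p2 algebra_simps flip: powr_add)
      finally show ?thesis by (simp only: nt)
    qed
    have l2: "b m * (r' m powr n * (l / r' m) powr q) = l powr t * B m"
    proof -
      have "l / r' m = 2 powr (- (real m + 1))" unfolding r'_def powr_minus_divide using l by simp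
      hence "b m * (r' m powr n * (l / r' m) powr q) = (l powr - (n - t) * l powr n) * (2 powr (real m * - (n - t)) * 2 powr ((real m + 1) * n) * 2 powr (- (real m + 1) * q))"
        using l by (simp add: b_def r'_def powr_mult powr_powr)
      also have "2 powr (real m * - (n - t)) * 2 powr ((real m + 1) * n) * 2 powr (- (real m + 1) * q) = B m"
        by (simp add: B_def p2 algebra_simps flip: powr_add)
      finally show ?thesis by (simp only: nt)
    qed
    \<comment> \<open>The minimum is estimated by 1 at scales up to \<open>l\<close>, and by the
      power of l/\<rho> at larger ones.\<close>
    have "ennreal (a m) * I (r m) \<le> ennreal (a m) * ennreal ((M + U) * (1 + D) * (r m powr n * 1 * W))"
      using M U D W
      by (intro mult_left_mono order.trans[OF I[OF r(1)]] ennreal_leI mult_right_mono) auto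
    also have "\<dots> = ennreal ((M + U) * (1 + D) * (a m * (r m powr n) * W))"
      using M U D W by (subst ennreal_mult[symmetric]) (auto simp: a_def mult_ac)
    finally have 1: "ennreal (a m) * I (r m) \<le> ennreal ((M + U) * (1 + D) * (l powr t * A m * W))"
      by (simp only: l1)
    have "ennreal (b m) * I (r' m) \<le> ennreal (b m) * ennreal ((M + U) * (1 + D) * (r' m powr n * (l / r' m) powr q * W))"
      using M U D W
      by (intro mult_left_mono order.trans[OF I[OF r(2)]] ennreal_leI mult_right_mono) auto
    also have "\<dots> = ennreal ((M + U) * (1 + D) * (b m * (r' m powr n * (l / r' m) powr q) * W))"
      using M U D W by (subst ennreal_mult[symmetric]) (auto simp: b_def mult_ac)
    finally have 2: "ennreal (b m) * I (r' m) \<le> ennreal ((M + U) * (1 + D) * (l powr t * B m * W))"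
      by (simp only: l2)
    have "ennreal (a m) * I (r m) + ennreal (b m) * I (r' m) \<le>
       ennreal ((M + U) * (1 + D) * (l powr t * A m * W)) + ennreal ((M + U) * (1 + D) * (l powr t * B m * W))"
      by (intro add_mono 1 2)
    also have "\<dots> = ennreal ((M + U) * (1 + D) * (l powr t * W) * (A m + B m))"
      using M U D W AB0 by (subst ennreal_plus[symmetric]) (auto simp: algebra_simps)
    finally show "ennreal (a m) * I (r m) + ennreal (b m) * I (r' m) \<le> ennreal ((M + U) * (1 + D) * (l powr t * W) * (A m + B m))" .
  qed
  also have "\<dots> = ennreal (\<Sum>m. (M + U) * (1 + D) * (l powr t * W) * (A m + B m))"
    using M U D W AB AB0 by (intro suminf_ennreal2 mult_nonneg_nonneg summable_mult summable_add) auto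
  also have "\<dots> = ennreal ((M + U) * (1 + D) * (l powr t * W) * (\<Sum>m. A m + B m))"
    using AB by (subst suminf_mult) (auto intro: summable_add)
  also have "\<dots> = ennreal (C * (1 + D) * (l powr t * W))"
    by (auto simp: C_def mult_ac)
  finally show ?thesis by (simp add: n_def W_def C)
qed

section \<open>Cantor sets with prescribed scales\<close>

text \<open>These are the left endpoints of the intervals of a stage. Each interval keeps its two
  end pieces of length \<open>l (Suc j)\<close>, so the second child begins at offset
  \<open>l j - l (Suc j)\<close>.\<close>

fun cantor_starts :: "(nat \<Rightarrow> real) \<Rightarrow> nat \<Rightarrow> real set" where
  "cantor_starts l 0 = {0}"
| "cantor_starts l (Suc j) = cantor_starts l j \<union> (\<lambda>a. a + (l j - l (Suc j))) ` cantor_starts l j"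

definition cantor_level :: "(nat \<Rightarrow> real) \<Rightarrow> nat \<Rightarrow> real set" where
  "cantor_level l j = (\<Union>a\<in>cantor_starts l j. {a..a + l j})"

text \<open>The bound \<theta> < 1/2, uniform in the stage, leaves a middle gap of relative length
  at least 1 - 2\<theta> in every interval; this makes each shell a fixed fraction of its
  dust.\<close>

locale cantor_scales =
  fixes l :: "nat \<Rightarrow> real" and \<theta> :: real
  assumes l_pos: "l j > 0" and l_Suc: "l (Suc j) \<le> \<theta> * l j" and \<theta>: "0 < \<theta>" "\<theta> < 1 / 2"
begin

abbreviation "S \<equiv> cantor_starts l"
abbreviation "K \<equiv> cantor_level l"

lemma two_l_Suc: "2 * l (Suc j) < l j"
proof -
  have "\<theta> * l j < 1 / 2 * l j" using \<theta> l_pos by (intro mult_strict_right_mono) auto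
  thus ?thesis using l_Suc[of j] by simp
qed

lemma l_Suc_less: "l (Suc j) < l j"
  using two_l_Suc[of j] l_pos[of "Suc j"] by simp

lemma l_mono: "i \<le> j \<Longrightarrow> l j \<le> l i"
  by (rule lift_Suc_antimono_le[of l]) (auto intro: less_imp_le l_Suc_less)

lemma l_le_power: "l j \<le> \<theta> ^ j * l 0"
proof (induction j)
  case (Suc j)
  have "\<theta> * l j \<le> \<theta> * (\<theta> ^ j * l 0)" using \<theta> Suc by (intro mult_left_mono) auto
  thus ?case using l_Suc[of j] by simp
qed simp

lemma l_tendsto_0: "l \<longlonglongrightarrow> 0"
proof (rule tendsto_sandwich[of "\<lambda>_. 0" l sequentially "\<lambda>j. \<theta> ^ j * l 0"])
  have "(\<lambda>j. \<theta> ^ j * l 0) \<longlonglongrightarrow> 0 * l 0"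
    using \<theta> by (intro tendsto_intros LIMSEQ_power_zero) auto
  thus "(\<lambda>j. \<theta> ^ j * l 0) \<longlonglongrightarrow> 0" by simp
qed (auto intro!: always_eventually less_imp_le[OF l_pos] l_le_power)

lemma scale_exists:
  assumes "0 < r" "r \<le> l 0"
  obtains i where "l (Suc i) < r" "r \<le> l i"
proof -
  from order_tendstoD(2)[OF l_tendsto_0 assms(1)] obtain N where N: "l N < r"
    by (auto simp: eventually_sequentially)
  define i where "i = (LEAST i. l i < r)"
  have i: "l i < r" unfolding i_def by (rule LeastI[of _ N]) (rule N)
  with assms obtain i' where i': "i = Suc i'" by (cases i) auto
  have "\<not> l i' < r" using not_less_Least[of i' "\<lambda>i. l i < r"] i' by (simp add: i_def)
  thus ?thesis using that[of i'] i i' by simp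
qed

lemma finite_starts [simp]: "finite (S j)" by (induction j) auto

text \<open>Quantitative disjointness of the intervals of one stage. Two children of one parent are
  g = l_j - l_(j+1) > l_(j+1) apart; for distinct parents the separation l_j drops by at most g,
  which leaves l_(j+1).\<close>

lemma starts_sep:
  assumes "a \<in> S j" "b \<in> S j" "a < b"
  shows "l j < b - a"
  using assms
proof (induction j arbitrary: a b)
  case (Suc j)
  define g where "g = l j - l (Suc j)"
  have g: "g > l (Suc j)" using two_l_Suc[of j] by (simp add: g_def)
  obtain a' e where a: "a' \<in> S j" "a = a' + e" "e = 0 \<or> e = g"
    using Suc.prems(1) by (auto simp: g_def intro: that[of _ 0] that)
  obtain b' f where b: "b' \<in> S j" "b = b' + f" "f = 0 \<or> f = g"
    using Suc.prems(2) by (auto simp: g_def intro: that[of _ 0] that)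
  consider "a' = b'" | "a' < b'" | "b' < a'" by linarith
  thus ?case
  proof cases
    case 1 thus ?thesis using a b g Suc.prems l_pos[of "Suc j"] by auto
  next
    case 2
    from Suc.IH[OF a(1) b(1) 2] show ?thesis using a b g l_pos[of "Suc j"] by (auto simp: g_def)
  next
    case 3
    from Suc.IH[OF b(1) a(1) 3] show ?thesis using a b g l_pos[of "Suc j"] Suc.prems by (auto simp: g_def)
  qed
qed auto

lemma level_measurable [measurable]: "K j \<in> sets borel"
  unfolding cantor_level_def by (intro sets.finite_UN) auto

lemma level_SucE:
  assumes "x \<in> K (Suc j)"
  obtains b f where "b \<in> S j" "x \<in> {b + f..b + f + l (Suc j)}" "f = 0 \<or> f = l j - l (Suc j)"
proof -
  from assms obtain c where c: "c \<in> S (Suc j)" "x \<in> {c..c + l (Suc j)}"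
    unfolding cantor_level_def by blast
  from c(1) show ?thesis
    using that[of c 0] that[of _ "l j - l (Suc j)"] c(2) by auto
qed

lemma level_Suc_Int:
  assumes "a \<in> S j"
  shows "K (Suc j) \<inter> {a..a + l j} = {a..a + l (Suc j)} \<union> {a + l j - l (Suc j)..a + l j}"
proof -
  define g where "g = l j - l (Suc j)"
  have g: "g > l (Suc j)" using two_l_Suc[of j] by (simp add: g_def)
  have "x \<in> {a..a + l (Suc j)} \<union> {a + l j - l (Suc j)..a + l j}"
    if x: "x \<in> K (Suc j)" "x \<in> {a..a + l j}" for x
  proof -
    obtain b' f where b: "b' \<in> S j" "x \<in> {b' + f..b' + f + l (Suc j)}" "f = 0 \<or> f = g"
      using level_SucE[OF x(1)] unfolding g_def by blast
    have "x \<in> {b'..b' + l j}" using b g l_pos[of "Suc j"] by (auto simp: g_def)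
    hence "\<not> a < b'" "\<not> b' < a"
      using starts_sep[OF assms b(1)] starts_sep[OF b(1) assms] x(2) by auto
    hence "b' = a" by simp
    thus ?thesis using b x(2) by (auto simp: g_def)
  qed
  moreover have "{a..a + l (Suc j)} \<union> {a + l j - l (Suc j)..a + l j} \<subseteq> K (Suc j)"
    using assms unfolding cantor_level_def by force
  moreover have "{a..a + l (Suc j)} \<union> {a + l j - l (Suc j)..a + l j} \<subseteq> {a..a + l j}"
    using l_Suc_less[of j] l_pos[of "Suc j"] by auto
  ultimately show ?thesis by blast
qed

lemma level_Suc_subset: "K (Suc j) \<subseteq> K j"
proof
  fix x assume "x \<in> K (Suc j)"
  then obtain b' f where b: "b' \<in> S j" "x \<in> {b' + f..b' + f + l (Suc j)}" "f = 0 \<or> f = l j - l (Suc j)"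
    by (rule level_SucE)
  have "x \<in> {b'..b' + l j}" using b l_Suc_less[of j] l_pos[of "Suc j"] by auto
  thus "x \<in> K j" using b(1) by (auto simp: cantor_level_def)
qed

lemma level_mono: "i \<le> j \<Longrightarrow> K j \<subseteq> K i"
  by (rule lift_Suc_antimono_le[of K]) (auto intro: level_Suc_subset[THEN subsetD])

text \<open>Downward induction from stage \<open>k\<close>: an interval meets the next stage in its
  two children, which carry equal measure.\<close>

lemma level_piece:
  assumes "a \<in> S i" "i \<le> k"
  shows "emeasure lborel (K k \<inter> {a..a + l i}) = ennreal (2 ^ (k - i) * l k)"
  using assms(2,1)
proof (induction i arbitrary: a rule: inc_induct)
  case base
  have "K k \<inter> {a..a + l k} = {a..a + l k}" using base by (auto simp: cantor_level_def)
  thus ?case using l_pos[of k] by simp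
next
  case (step i)
  define b where "b = a + (l i - l (Suc i))"
  have ab: "a \<in> S (Suc i)" "b \<in> S (Suc i)" using step by (auto simp: b_def)
  have bi: "b + l (Suc i) = a + l i" by (simp add: b_def)
  have "K k \<inter> {a..a + l i} = K k \<inter> (K (Suc i) \<inter> {a..a + l i})"
    using level_mono[of "Suc i" k] step by auto
  also have "\<dots> = (K k \<inter> {a..a + l (Suc i)}) \<union> (K k \<inter> {b..b + l (Suc i)})"
    unfolding level_Suc_Int[OF step.prems] bi by (auto simp: b_def)
  also have "emeasure lborel \<dots> = emeasure lborel (K k \<inter> {a..a + l (Suc i)}) + emeasure lborel (K k \<inter> {b..b + l (Suc i)})"
    using two_l_Suc[of i] by (intro plus_emeasure[symmetric]) (auto simp: b_def)
  also have "\<dots> = ennreal (2 ^ (k - Suc i) * l k) + ennreal (2 ^ (k - Suc i) * l k)"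
    using step.IH ab by simp
  also have "\<dots> = ennreal (2 ^ (k - i) * l k)"
    using step l_pos[of k] by (subst ennreal_plus[symmetric]) (auto simp: Suc_diff_Suc[symmetric] simp flip: power_Suc)
  finally show ?case .
qed

lemma level_subset: "K k \<subseteq> {0..l 0}"
  using level_mono[of 0 k] by (auto simp: cantor_level_def)

lemma emeasure_level: "emeasure lborel (K k) = ennreal (2 ^ k * l k)"
  using level_piece[of 0 0 k] level_subset[of k] by (simp add: Int_absorb2)

text \<open>The window meets at most two intervals of stage \<open>i\<close>: a third one between
  the extremes would put their starts more than 2 l_i apart, while both can touch the window only if
  the starts differ by at most r + l_i.\<close>

lemma emeasure_level_Int:
  assumes "r \<le> l i" "i \<le> k"
  shows "emeasure lborel (K k \<inter> {u..u + r}) \<le> ennreal (2 * (2 ^ (k - i) * l k))"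
proof (cases "r < 0")
  case False
  define A where "A = {a \<in> S i. {a..a + l i} \<inter> {u..u + r} \<noteq> {}}"
  have fin: "finite A" by (simp add: A_def)
  have sub: "K k \<inter> {u..u + r} \<subseteq> (\<Union>a\<in>A. K k \<inter> {a..a + l i})"
    using level_mono[OF assms(2)] unfolding A_def cantor_level_def[of l i] by fastforce
  show ?thesis
  proof (cases "A = {}")
    case True
    with sub have "K k \<inter> {u..u + r} = {}" by simp
    thus ?thesis by simp
  next
    case ne: False
    define m where "m = Min A"
    define M where "M = Max A"
    have mM: "m \<in> A" "M \<in> A" using fin ne by (auto simp: m_def M_def)
    have "a = m \<or> a = M" if a: "a \<in> A" for a
    proof (rule ccontr)
      assume "\<not> (a = m \<or> a = M)"
      moreover have "m \<le> a" "a \<le> M" using fin a by (auto simp: m_def M_def)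
      ultimately have "m < a" "a < M" by auto
      hence "l i < a - m" "l i < M - a" using a mM starts_sep by (auto simp: A_def)
      moreover have "M \<le> u + r" "u \<le> m + l i" using mM by (auto simp: A_def)
      ultimately show False using assms(1) by simp
    qed
    hence "K k \<inter> {u..u + r} \<subseteq> (K k \<inter> {m..m + l i}) \<union> (K k \<inter> {M..M + l i})"
      using sub by fastforce
    hence "emeasure lborel (K k \<inter> {u..u + r}) \<le> emeasure lborel ((K k \<inter> {m..m + l i}) \<union> (K k \<inter> {M..M + l i}))"
      by (intro emeasure_mono) auto
    also have "\<dots> \<le> emeasure lborel (K k \<inter> {m..m + l i}) + emeasure lborel (K k \<inter> {M..M + l i})"
      by (intro emeasure_subadditive) auto
    also have "\<dots> = ennreal (2 ^ (k - i) * l k) + ennreal (2 ^ (k - i) * l k)"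
      using mM assms by (simp add: level_piece A_def)
    also have "\<dots> = ennreal (2 * (2 ^ (k - i) * l k))"
      using l_pos[of k] by (subst ennreal_plus[symmetric]) auto
    finally show ?thesis .
  qed
qed auto

end

section \<open>Product dusts and their shells in n dimensions\<close>

lemma emeasure_product_set:
  assumes [measurable]: "\<And>b. b \<in> Basis \<Longrightarrow> A b \<in> sets borel"
  shows "{x :: 'a::euclidean_space. \<forall>b\<in>Basis. x \<bullet> b \<in> A b} \<in> sets borel"
    and "emeasure lborel {x :: 'a::euclidean_space. \<forall>b\<in>Basis. x \<bullet> b \<in> A b} = (\<Prod>b\<in>Basis. emeasure lborel (A b))"
proof -
  have "{x :: 'a. \<forall>b\<in>Basis. x \<bullet> b \<in> A b} = (\<Inter>b\<in>Basis. (\<lambda>x. x \<bullet> b) -` A b \<inter> space borel)" by auto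
  also have "\<dots> \<in> sets borel" by (intro sets.finite_INT measurable_sets[of _ borel borel]) auto
  finally show *[measurable]: "{x :: 'a. \<forall>b\<in>Basis. x \<bullet> b \<in> A b} \<in> sets borel" .
  have "indicator {x :: 'a. \<forall>b\<in>Basis. x \<bullet> b \<in> A b} x = (\<Prod>b\<in>Basis. indicator (A b) (x \<bullet> b) :: ennreal)" for x
    by (auto simp: indicator_def)
  hence "emeasure lborel {x :: 'a. \<forall>b\<in>Basis. x \<bullet> b \<in> A b} =
     (\<integral>\<^sup>+x. (\<Prod>b\<in>Basis. indicator (A b) (x \<bullet> b)) \<partial>(lborel :: 'a measure))"
    using * by (simp flip: nn_integral_indicator)
  also have "\<dots> = (\<Prod>b\<in>Basis. emeasure lborel (A b))"
    by (subst nn_integral_lborel_prod) auto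
  finally show "emeasure lborel {x :: 'a. \<forall>b\<in>Basis. x \<bullet> b \<in> A b} = (\<Prod>b\<in>Basis. emeasure lborel (A b))" .
qed

context cantor_scales
begin

definition dust :: "nat \<Rightarrow> 'a::euclidean_space set" where
  "dust j = {x. \<forall>b\<in>Basis. x \<bullet> b \<in> K j}"

text \<open>Functions are built on shells and not on the nested dusts because disjoint supports let
  p-th powers pass through sums.\<close>

definition shell :: "nat \<Rightarrow> 'a::euclidean_space set" where
  "shell j = dust j - dust (Suc j)"

lemma dust_measurable [measurable]: "dust j \<in> sets borel"
  unfolding dust_def by (rule emeasure_product_set) simp

lemma shell_measurable [measurable]: "shell j \<in> sets borel"
  unfolding shell_def by simp

lemma dust_mono: "i \<le> j \<Longrightarrow> dust j \<subseteq> dust i"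
  using level_mono[of i j] by (auto simp: dust_def)

lemma shell_subset: "shell j \<subseteq> dust j"
  by (auto simp: shell_def)

lemma disjoint_shell: "i \<noteq> j \<Longrightarrow> shell i \<inter> shell j = {}"
  using dust_mono[of "Suc i" j] dust_mono[of "Suc j" i] by (cases "i < j") (auto simp: shell_def)

lemma emeasure_dust: "emeasure lborel (dust k :: 'a::euclidean_space set) = ennreal ((2 ^ k * l k) ^ DIM('a))"
  unfolding dust_def using l_pos[of k] by (subst emeasure_product_set) (auto simp: emeasure_level ennreal_power)

lemma emeasure_dust_Int:
  fixes u :: "'a::euclidean_space"
  assumes "r \<le> l i" "i \<le> k"
  shows "emeasure lborel (dust k \<inter> cbox u (u + r *\<^sub>R One)) \<le> ennreal ((2 * (2 ^ (k - i) * l k)) ^ DIM('a))"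
proof -
  have "dust k \<inter> cbox u (u + r *\<^sub>R One) = {x. \<forall>b\<in>Basis. x \<bullet> b \<in> K k \<inter> {u \<bullet> b..u \<bullet> b + r}}"
    by (auto simp: dust_def mem_box algebra_simps)
  also have "emeasure lborel \<dots> = (\<Prod>b\<in>Basis. emeasure lborel (K k \<inter> {u \<bullet> b..u \<bullet> b + r}))"
    by (rule emeasure_product_set) auto
  also have "\<dots> \<le> (\<Prod>b\<in>(Basis::'a set). ennreal (2 * (2 ^ (k - i) * l k)))"
    by (intro prod_mono_ennreal emeasure_level_Int assms)
  also have "\<dots> = ennreal ((2 * (2 ^ (k - i) * l k)) ^ DIM('a))"
    using l_pos[of k] by (simp add: ennreal_power)
  finally show ?thesis .
qed

text \<open>The next dust occupies at most (2\<theta>)^n \<le> 2\<theta> of the present one.\<close>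

lemma emeasure_shell_ge:
  "ennreal ((1 - 2 * \<theta>) * (2 ^ k * l k) ^ DIM('a)) \<le> emeasure lborel (shell k :: 'a::euclidean_space set)"
proof -
  define n where "n = DIM('a)"
  have n: "n > 0" by (simp add: n_def)
  have "2 ^ Suc k * l (Suc k) \<le> 2 * \<theta> * (2 ^ k * l k)"
    using l_Suc[of k] by simp
  hence "(2 ^ Suc k * l (Suc k)) ^ n \<le> (2 * \<theta> * (2 ^ k * l k)) ^ n"
    using l_pos[of "Suc k"] by (intro power_mono) auto
  also have "\<dots> = (2 * \<theta>) ^ n * (2 ^ k * l k) ^ n" by (simp only: power_mult_distrib)
  also have "(2 * \<theta>) ^ n \<le> (2 * \<theta>) ^ 1" using \<theta> n by (intro power_decreasing) auto
  finally have "(2 ^ Suc k * l (Suc k)) ^ n \<le> 2 * \<theta> * (2 ^ k * l k) ^ n"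
    using l_pos[of k] by (auto intro: mult_right_mono order.trans)
  hence le: "(1 - 2 * \<theta>) * (2 ^ k * l k) ^ n \<le> (2 ^ k * l k) ^ n - (2 ^ Suc k * l (Suc k)) ^ n"
    by (simp add: algebra_simps)
  have "emeasure lborel (shell k :: 'a set) = emeasure lborel (dust k :: 'a set) - emeasure lborel (dust (Suc k) :: 'a set)"
    unfolding shell_def by (intro emeasure_Diff) (auto simp: emeasure_dust dust_mono)
  also have "\<dots> = ennreal ((2 ^ k * l k) ^ n - (2 ^ Suc k * l (Suc k)) ^ n)"
    using l_pos[of "Suc k"] unfolding emeasure_dust n_def by (intro ennreal_minus) auto
  finally show ?thesis using ennreal_leI[OF le] by (simp add: n_def)
qed

text \<open>Take the stage-j cell of \<open>x\<close> and confine one coordinate to the open middle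
  gap. One bad coordinate already leaves the next product set, and the part cut out is a fixed
  fraction of the cell.\<close>

lemma shell_near_point:
  fixes x :: "'a::euclidean_space"
  assumes "x \<in> dust j"
  obtains B where "B \<in> sets borel" "B \<subseteq> shell j" "ennreal ((1 - 2 * \<theta>) * l j ^ DIM('a)) \<le> emeasure lborel B"
    "\<And>y. y \<in> B \<Longrightarrow> norm (x - y) \<le> real DIM('a) * l j"
proof -
  have "\<forall>b\<in>Basis. \<exists>a\<in>S j. x \<bullet> b \<in> {a..a + l j}"
    using assms by (auto simp: dust_def cantor_level_def)
  then obtain a where a: "\<And>b. b \<in> Basis \<Longrightarrow> a b \<in> S j" "\<And>b. b \<in> Basis \<Longrightarrow> x \<bullet> b \<in> {a b..a b + l j}"
    by metis
  obtain e :: 'a where e: "e \<in> Basis" using nonempty_Basis by blast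
  define A where "A b = (if b = e then {a b + l (Suc j)<..<a b + l j - l (Suc j)} else {a b..a b + l j})" for b
  have A[measurable]: "A b \<in> sets borel" for b by (simp add: A_def)
  have Asub: "A b \<subseteq> {a b..a b + l j}" for b using l_pos[of "Suc j"] by (auto simp: A_def)
  define B where "B = {y. \<forall>b\<in>Basis. y \<bullet> b \<in> A b}"
  show ?thesis
  proof (rule that[of B])
    show "B \<in> sets borel" unfolding B_def by (rule emeasure_product_set) simp
    show "B \<subseteq> shell j"
    proof
      fix y assume y: "y \<in> B"
      have "y \<bullet> b \<in> K j" if "b \<in> Basis" for b
        using y that a(1)[OF that] Asub[of b] unfolding B_def cantor_level_def by blast
      moreover have "y \<bullet> e \<notin> K (Suc j)"
      proof
        assume "y \<bullet> e \<in> K (Suc j)"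
        moreover have ye: "y \<bullet> e \<in> A e" using y e by (auto simp: B_def)
        hence "y \<bullet> e \<in> {a e..a e + l j}" using Asub by blast
        ultimately have "y \<bullet> e \<in> {a e..a e + l (Suc j)} \<union> {a e + l j - l (Suc j)..a e + l j}"
          using level_Suc_Int[OF a(1)[OF e]] by blast
        thus False using ye by (auto simp: A_def)
      qed
      ultimately show "y \<in> shell j" using e by (auto simp: shell_def dust_def)
    qed
    show "norm (x - y) \<le> real DIM('a) * l j" if y: "y \<in> B" for y
    proof -
      have "norm (x - y) \<le> (\<Sum>b\<in>Basis. \<bar>(x - y) \<bullet> b\<bar>)" by (rule norm_le_l1)
      also have "\<dots> \<le> (\<Sum>b\<in>(Basis::'a set). l j)"
      proof (rule sum_mono)
        fix b :: 'a assume b: "b \<in> Basis"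
        have "y \<bullet> b \<in> {a b..a b + l j}" using y b Asub[of b] by (auto simp: B_def)
        with a(2)[OF b] show "\<bar>(x - y) \<bullet> b\<bar> \<le> l j" by (auto simp: inner_diff_left)
      qed
      finally show ?thesis by simp
    qed
    have "(1 - 2 * \<theta>) * l j ^ DIM('a) = (l j - 2 * (\<theta> * l j)) * l j ^ (DIM('a) - 1)"
      by (subst power_eq_if) (auto simp: algebra_simps)
    also have "\<dots> \<le> (l j - 2 * l (Suc j)) * l j ^ (DIM('a) - 1)"
      using l_Suc[of j] l_pos[of j] by (intro mult_right_mono) auto
    finally have "ennreal ((1 - 2 * \<theta>) * l j ^ DIM('a)) \<le> ennreal ((l j - 2 * l (Suc j)) * l j ^ (DIM('a) - 1))"
      by (rule ennreal_leI)
    also have "\<dots> = ennreal (l j - 2 * l (Suc j)) * ennreal (l j) ^ (DIM('a) - 1)"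
      using l_pos[of j] two_l_Suc[of j] by (simp add: ennreal_mult ennreal_power)
    also have "\<dots> = emeasure lborel (A e) * (\<Prod>b\<in>Basis - {e}. emeasure lborel (A b))"
    proof -
      have "(\<Prod>b\<in>Basis - {e}. emeasure lborel (A b)) = (\<Prod>b\<in>Basis - {e}. ennreal (l j))"
        using l_pos[of j] by (intro prod.cong) (auto simp: A_def)
      thus ?thesis using two_l_Suc[of j] e by (simp add: A_def)
    qed
    also have "\<dots> = emeasure lborel B"
      unfolding B_def using e by (subst emeasure_product_set) (auto simp: prod.remove[of _ e])
    finally show "ennreal ((1 - 2 * \<theta>) * l j ^ DIM('a)) \<le> emeasure lborel B" .
  qed
qed

text \<open>Around \<open>x\<close> the shell has measure of order l_j^n within distance n l_j,
  where the kernel is at least a multiple of l_j^(s-n). Since all these distances are bounded by n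
  l_0, one constant serves every stage.\<close>

lemma shell_potential_ge:
  fixes s :: real
  assumes s: "0 < s" "s < real DIM('a::euclidean_space)"
  obtains c where "c > 0"
    "\<And>j (x :: 'a). x \<in> dust j \<Longrightarrow>
       ennreal (c * l j powr s) \<le> (\<integral>\<^sup>+y\<in>shell j. ennreal (bessel_kernel s (x - y)) \<partial>lborel)"
proof -
  define n where "n = real DIM('a)"
  have n: "n > 0" by (simp add: n_def)
  have "n * l 0 > 0" using n l_pos by simp
  from bessel_kernel_lower[OF s this] obtain c where c: "c > 0"
    "\<And>(x :: 'a) r. x \<noteq> 0 \<Longrightarrow> norm x \<le> r \<Longrightarrow> r \<le> n * l 0 \<Longrightarrow> c * r powr (s - n) \<le> bessel_kernel s x"
    unfolding n_def by blast
  define C where "C = c * n powr (s - n) * (1 - 2 * \<theta>)"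
  show ?thesis
  proof (rule that[of C])
    show "C > 0" using c n \<theta> by (simp add: C_def)
    fix j and x :: 'a assume "x \<in> dust j"
    then obtain B where B[measurable]: "B \<in> sets borel" and B': "B \<subseteq> shell j"
      "ennreal ((1 - 2 * \<theta>) * l j ^ DIM('a)) \<le> emeasure lborel B"
      "\<And>y. y \<in> B \<Longrightarrow> norm (x - y) \<le> n * l j"
      unfolding n_def using shell_near_point by blast
    have "C * l j powr s = c * (n * l j) powr (s - n) * ((1 - 2 * \<theta>) * l j ^ DIM('a))"
    proof -
      have "l j powr s = l j powr (s - n) * l j powr n" by (simp flip: powr_add)
      also have "l j powr n = l j ^ DIM('a)" using l_pos[of j] by (simp add: n_def powr_realpow)
      finally show ?thesis using n l_pos[of j] by (simp add: C_def powr_mult)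
    qed
    hence "ennreal (C * l j powr s) = ennreal (c * (n * l j) powr (s - n)) * ennreal ((1 - 2 * \<theta>) * l j ^ DIM('a))"
      using c \<theta> l_pos[of j] by (simp add: ennreal_mult)
    also have "\<dots> \<le> ennreal (c * (n * l j) powr (s - n)) * emeasure lborel B"
      by (intro mult_left_mono B') auto
    also have "\<dots> = (\<integral>\<^sup>+y. ennreal (c * (n * l j) powr (s - n)) * indicator B y \<partial>lborel)"
      by (simp add: nn_integral_cmult_indicator)
    also have "\<dots> \<le> (\<integral>\<^sup>+y\<in>shell j. ennreal (bessel_kernel s (x - y)) \<partial>lborel)"
    proof (rule nn_integral_mono_AE)
      show "AE y in lborel. ennreal (c * (n * l j) powr (s - n)) * indicator B y
         \<le> ennreal (bessel_kernel s (x - y)) * indicator (shell j) y"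
        using AE_lborel_singleton[of x]
      proof eventually_elim
        case (elim y)
        show ?case
        proof (cases "y \<in> B")
          case True
          have "c * (n * l j) powr (s - n) \<le> bessel_kernel s (x - y)"
            using elim True B'(3) l_mono[of 0 j] n by (intro c(2)) auto
          thus ?thesis using True B'(1) by (auto simp: indicator_def intro: ennreal_leI)
        qed auto
      qed
    qed
    finally show "ennreal (C * l j powr s) \<le> (\<integral>\<^sup>+y\<in>shell j. ennreal (bessel_kernel s (x - y)) \<partial>lborel)" .
  qed
qed

text \<open>For injective \<open>k\<close> at most one term is nonzero at each point, so the real
  series always converges.\<close>

definition shell_sum :: "(nat \<Rightarrow> real) \<Rightarrow> (nat \<Rightarrow> nat) \<Rightarrow> 'a::euclidean_space \<Rightarrow> real" where
  "shell_sum a k y = (\<Sum>m. a m * indicator (shell (k m)) y)"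

lemma shell_sum_measurable [measurable]: "shell_sum a k \<in> borel_measurable borel"
  unfolding shell_sum_def by measurable

lemma shell_sum_eq:
  assumes "inj k" "y \<in> shell (k m)"
  shows "shell_sum a k y = a m"
proof -
  have "y \<notin> shell (k i)" if "i \<noteq> m" for i
    using disjoint_shell[of "k i" "k m"] assms that by (auto dest: injD)
  hence "shell_sum a k y = (\<Sum>i. if i = m then a i else 0)"
    unfolding shell_sum_def using assms(2) by (intro suminf_cong) auto
  also have "\<dots> = a m" using sums_single[of m a] by (rule sums_unique[symmetric])
  finally show ?thesis .
qed

lemma shell_sum_eq_0: "(\<And>m. y \<notin> shell (k m)) \<Longrightarrow> shell_sum a k y = 0"
  by (simp add: shell_sum_def)

lemma shell_sum_nonneg: "inj k \<Longrightarrow> (\<And>m. a m \<ge> 0) \<Longrightarrow> shell_sum a k y \<ge> 0"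
  by (cases "\<exists>m. y \<in> shell (k m)") (auto simp: shell_sum_eq shell_sum_eq_0)

text \<open>Disjointness moves the power inside the sum; off all shells both sides vanish, as
  \<open>0 powr p\<close> is 0. Stating it in \<open>ennreal\<close> lets the integral pass through
  the series without a summability condition.\<close>

lemma shell_sum_powr:
  assumes "inj k" "\<And>m. a m \<ge> 0"
  shows "ennreal (\<bar>shell_sum a k y\<bar> powr p) = (\<Sum>m. ennreal (a m powr p) * indicator (shell (k m)) y)"
proof (cases "\<exists>m. y \<in> shell (k m)")
  case True
  then obtain m where m: "y \<in> shell (k m)" ..
  have "y \<notin> shell (k i)" if "i \<noteq> m" for i
    using disjoint_shell[of "k i" "k m"] assms(1) m that by (auto dest: injD)
  hence "(\<Sum>m. ennreal (a m powr p) * indicator (shell (k m)) y) = (\<Sum>i. if i = m then ennreal (a i powr p) else 0)"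
    using m by (intro suminf_cong) auto
  also have "\<dots> = ennreal (a m powr p)"
    using sums_single[of m "\<lambda>i. ennreal (a i powr p)"] by (rule sums_unique[symmetric])
  finally show ?thesis using shell_sum_eq[OF assms(1) m] assms(2) by simp
qed (simp add: shell_sum_eq_0)

lemma nn_integral_shell_sum_powr:
  fixes Q :: "'a::euclidean_space set"
  assumes "inj k" "\<And>m. a m \<ge> 0" and [measurable]: "Q \<in> sets borel"
  shows "(\<integral>\<^sup>+y\<in>Q. ennreal (\<bar>shell_sum a k y\<bar> powr p) \<partial>lborel) =
    (\<Sum>m. ennreal (a m powr p) * emeasure lborel (shell (k m) \<inter> Q))"
proof -
  have "(\<integral>\<^sup>+y\<in>Q. ennreal (\<bar>shell_sum a k y\<bar> powr p) \<partial>lborel) =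
     (\<integral>\<^sup>+y. (\<Sum>m. ennreal (a m powr p) * indicator (shell (k m) \<inter> Q) y) \<partial>lborel)"
    unfolding shell_sum_powr[OF assms(1,2)]
    by (intro nn_integral_cong) (simp add: indicator_def)
  also have "\<dots> = (\<Sum>m. ennreal (a m powr p) * emeasure lborel (shell (k m) \<inter> Q))"
    by (subst nn_integral_suminf) (auto simp: nn_integral_cmult_indicator)
  finally show ?thesis .
qed

lemma shell_sum_ge_sum:
  assumes "inj k" "\<And>m. a m \<ge> 0" "finite A"
  shows "(\<Sum>m\<in>A. ennreal (a m) * indicator (shell (k m)) y) \<le> ennreal (shell_sum a k y)"
proof -
  have "(\<Sum>m\<in>A. ennreal (a m) * indicator (shell (k m)) y) \<le> (\<Sum>m. ennreal (a m) * indicator (shell (k m)) y)"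
    using assms(3) by (intro sum_le_suminf) auto
  also have "\<dots> = ennreal (shell_sum a k y)"
    using shell_sum_powr[where k = k and a = a and y = y and p = 1, OF assms(1,2)] shell_sum_nonneg[where k = k and a = a and y = y, OF assms(1)] assms(2) by simp
  finally show ?thesis .
qed

text \<open>Nonnegative terms may be dropped, so any finite set of shells gives a lower bound. The
  test function uses all stages below \<open>k\<close>, the potential of \<open>h\<close> just
  one.\<close>

lemma shell_sum_potential_ge:
  fixes s :: real and x :: "'a::euclidean_space"
  assumes "inj k" "\<And>m. a m \<ge> 0" "finite A" "s > 0"
    and c: "c \<ge> 0" "\<And>m. m \<in> A \<Longrightarrow> ennreal (c * l (k m) powr s) \<le> (\<integral>\<^sup>+y\<in>shell (k m). ennreal (bessel_kernel s (x - y)) \<partial>lborel)"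
  shows "ennreal (c * (\<Sum>m\<in>A. a m * l (k m) powr s)) \<le>
     (\<integral>\<^sup>+y. ennreal (bessel_kernel s (x - y)) * ennreal (shell_sum a k y) \<partial>lborel)"
proof -
  have "ennreal (c * (\<Sum>m\<in>A. a m * l (k m) powr s)) = (\<Sum>m\<in>A. ennreal (a m) * ennreal (c * l (k m) powr s))"
    using assms(2) c(1) by (simp add: sum_distrib_left mult_ac flip: ennreal_mult sum_ennreal)
  also have "\<dots> \<le> (\<Sum>m\<in>A. ennreal (a m) * (\<integral>\<^sup>+y\<in>shell (k m). ennreal (bessel_kernel s (x - y)) \<partial>lborel))"
    by (intro sum_mono mult_left_mono c) auto
  also have "\<dots> = (\<integral>\<^sup>+y. (\<Sum>m\<in>A. ennreal (a m) * (ennreal (bessel_kernel s (x - y)) * indicator (shell (k m)) y)) \<partial>lborel)"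
    by (subst nn_integral_sum) (auto simp: nn_integral_cmult)
  also have "\<dots> = (\<integral>\<^sup>+y. ennreal (bessel_kernel s (x - y)) * (\<Sum>m\<in>A. ennreal (a m) * indicator (shell (k m)) y) \<partial>lborel)"
    by (intro nn_integral_cong) (simp add: sum_distrib_left mult_ac)
  also have "\<dots> \<le> (\<integral>\<^sup>+y. ennreal (bessel_kernel s (x - y)) * ennreal (shell_sum a k y) \<partial>lborel)"
    by (intro nn_integral_mono mult_left_mono shell_sum_ge_sum assms) auto
  finally show ?thesis .
qed

end

section \<open>Critical scales\<close>

text \<open>Here \<open>x j\<close> is comparable to \<open>log (1 / l j)\<close>, and \<open>mass\<close> says that each cube of the
  \<open>j\<close>-th stage carries a fraction \<open>2\<^bsup>-nj\<^esup>\<close> equal to \<open>l\<^bsup>n-\<sigma>p\<^esup> x\<^bsup>-(p-1)\<^esup>\<close>. The exponent \<open>q\<close>, strictly between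
  \<open>t\<close> and \<open>\<sigma>\<close>, absorbs the logarithms. The parameter \<open>dim_type\<close> only fixes the type \<open>'a\<close>.\<close>
locale critical_scales = cantor_scales l \<theta>
  for l :: "nat \<Rightarrow> real" and \<theta> :: real and dim_type :: "'a::euclidean_space itself"
    and \<sigma> q p :: real and x :: "nat \<Rightarrow> real" and \<Theta> L :: real +
  assumes p: "p > 1" and q: "0 < q" "q < \<sigma>" and \<sigma>p: "\<sigma> * p < real DIM('a)"
    and x_ge_1: "x j \<ge> 1"
    and l0: "l 0 \<ge> 1"
    and mass: "(2 ^ j) ^ DIM('a) * l j powr (real DIM('a) - \<sigma> * p) = x j powr (p - 1)"
    and weight_mono: "l j powr (- (\<sigma> * p)) * x j powr (- (p - 1)) \<le> l (Suc j) powr (- (\<sigma> * p)) * x (Suc j) powr (- (p - 1))"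
    and energy_antimono: "l (Suc j) powr ((\<sigma> - q) * p) * x (Suc j) powr (p - 1) \<le> l j powr ((\<sigma> - q) * p) * x j powr (p - 1)"
    and \<Theta>: "\<Theta> \<ge> 1" "l j \<le> \<Theta> * l (Suc j)"
    and L: "L > 0" "1 - log 2 (l (Suc j) ^ DIM('a)) \<le> L * x j"
    and diverges: "\<not> summable (\<lambda>j. 1 / x j)"
begin

text \<open>The \<open>p\<close>-th power of the height at which the indicator of \<open>dust j\<close> has unit \<open>L\<^sup>p\<close> norm.\<close>
definition weight :: "nat \<Rightarrow> real" where
  "weight j = l j powr (- (\<sigma> * p)) * x j powr (- (p - 1))"

lemma weight_pos: "weight j > 0"
  using l_pos[of j] x_ge_1[of j] by (simp add: weight_def)

lemma weight_le: "i \<le> j \<Longrightarrow> weight i \<le> weight j"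
  by (rule lift_Suc_mono_le[of weight]) (simp_all only: weight_def weight_mono)

lemma energy_le: "i \<le> j \<Longrightarrow> l j powr ((\<sigma> - q) * p) * x j powr (p - 1) \<le> l i powr ((\<sigma> - q) * p) * x i powr (p - 1)"
  by (rule lift_Suc_antimono_le[of "\<lambda>j. l j powr ((\<sigma> - q) * p) * x j powr (p - 1)"]) (rule energy_antimono)

lemma \<sigma>_less_dim: "\<sigma> < real DIM('a)"
proof -
  have "\<sigma> * 1 < \<sigma> * p" using p q by (intro mult_strict_left_mono) auto
  thus ?thesis using \<sigma>p by linarith
qed

lemma l_powr_n: "l j ^ DIM('a) = l j powr real DIM('a)"
  using l_pos[of j] by (simp add: powr_realpow)

lemma weight_mass: "weight j * (2 ^ j * l j) ^ DIM('a) = 1"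
proof -
  have "weight j * (2 ^ j * l j) ^ DIM('a) = x j powr (- (p - 1)) * ((2 ^ j) ^ DIM('a) * (l j powr (- (\<sigma> * p)) * l j powr real DIM('a)))"
    by (simp add: weight_def power_mult_distrib l_powr_n mult_ac)
  also have "l j powr (- (\<sigma> * p)) * l j powr real DIM('a) = l j powr (real DIM('a) - \<sigma> * p)" by (simp flip: powr_add)
  also have "x j powr (- (p - 1)) * ((2 ^ j) ^ DIM('a) * l j powr (real DIM('a) - \<sigma> * p)) = x j powr (- (p - 1)) * x j powr (p - 1)"
    by (simp only: mass)
  also have "\<dots> = 1" using x_ge_1[of j] by (simp flip: powr_add)
  finally show ?thesis .
qed

text \<open>The equation \<open>mass\<close> solved for the share of one stage-i cube: here counting
  cells turns into growth in the side length.\<close>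

lemma inverse_count: "1 / (2 ^ i) ^ DIM('a) = l i powr (real DIM('a) - \<sigma> * p) * x i powr (- (p - 1))"
proof -
  have "(2 ^ i) ^ DIM('a) * (l i powr (real DIM('a) - \<sigma> * p) * x i powr (- (p - 1))) = 1"
    using mass[of i] x_ge_1[of i] by (simp add: mult.assoc[symmetric] flip: powr_add)
  thus ?thesis by (simp add: field_simps)
qed

lemma count_split:
  assumes "i \<le> k"
  shows "(2 * (2 ^ (k - i) * l k)) ^ DIM('a) = 2 ^ DIM('a) * ((2 ^ k * l k) ^ DIM('a) * (1 / (2 ^ i) ^ DIM('a)))"
proof -
  have "2 ^ (k - i) = 2 ^ k / (2 ^ i :: real)" using assms by (simp add: power_diff)
  thus ?thesis by (simp add: power_mult_distrib power_divide)
qed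

text \<open>A cube of side about l_i meets at most 2^n cells of stage \<open>i\<close>, each holding
  the share 2^(-ni) of a total normalised to 1 by \<open>weight\<close>. The bound does not depend
  on \<open>k\<close>, so it survives summation over stages.\<close>

lemma weighted_cube_bound:
  fixes u :: 'a
  assumes \<rho>: "0 < \<rho>" "\<rho> \<le> 1"
  shows "ennreal (weight k) * emeasure lborel (dust k \<inter> cbox u (u + \<rho> *\<^sub>R One))
    \<le> ennreal (2 ^ DIM('a) * \<Theta> powr (real DIM('a) - \<sigma> * p) * L powr (p - 1) *
        (\<rho> powr (real DIM('a) - \<sigma> * p) * (1 - log 2 (\<rho> ^ DIM('a))) powr (- (p - 1))))"
proof -
  \<comment> \<open>\<open>l0\<close> makes the initial cube large enough for every side length up
    to 1 to fall between two consecutive scales.\<close>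
  from scale_exists[of \<rho>] \<rho> l0 obtain i where i: "l (Suc i) < \<rho>" "\<rho> \<le> l i" by auto
  define \<Lambda> where "\<Lambda> = 1 - log 2 (\<rho> ^ DIM('a))"
  have "\<rho> ^ DIM('a) \<le> 1" using \<rho> by (intro power_le_one) auto
  hence "\<Lambda> \<ge> 1" using \<rho> by (simp add: \<Lambda>_def)
  \<comment> \<open>The lower bound on \<rho> is the finer scale, which is why \<open>L\<close>
    compares the logarithm at \<open>Suc i\<close> with \<open>x i\<close>.\<close>
  have "\<Lambda> \<le> 1 - log 2 (l (Suc i) ^ DIM('a))"
    using i \<rho> l_pos[of "Suc i"] by (auto simp: \<Lambda>_def intro!: power_mono)
  also have "\<dots> \<le> L * x i" by (rule L)
  finally have "(L * x i) powr (- (p - 1)) \<le> \<Lambda> powr (- (p - 1))"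
    using \<open>\<Lambda> \<ge> 1\<close> p by (intro powr_mono2') auto
  hence "L powr (p - 1) * (L * x i) powr (- (p - 1)) \<le> L powr (p - 1) * \<Lambda> powr (- (p - 1))"
    by (intro mult_left_mono) auto
  moreover have "L powr (p - 1) * (L * x i) powr (- (p - 1)) = x i powr (- (p - 1))"
  proof -
    have "L powr (p - 1) * (L * x i) powr (- (p - 1)) = (L powr (p - 1) * L powr (- (p - 1))) * x i powr (- (p - 1))"
      using L x_ge_1[of i] by (simp add: powr_mult)
    thus ?thesis using L by (simp flip: powr_add)
  qed
  ultimately have xi: "x i powr (- (p - 1)) \<le> L powr (p - 1) * \<Lambda> powr (- (p - 1))" by simp
  have "l i \<le> \<Theta> * l (Suc i)" by (rule \<Theta>)
  also have "\<dots> \<le> \<Theta> * \<rho>" using i \<Theta> by (intro mult_left_mono) auto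
  finally have li: "l i powr (real DIM('a) - \<sigma> * p) \<le> (\<Theta> * \<rho>) powr (real DIM('a) - \<sigma> * p)"
    using \<sigma>p l_pos[of i] by (intro powr_mono2) auto
  hence li: "l i powr (real DIM('a) - \<sigma> * p) \<le> \<Theta> powr (real DIM('a) - \<sigma> * p) * \<rho> powr (real DIM('a) - \<sigma> * p)"
    using \<Theta> \<rho> by (simp add: powr_mult)
  have main: "ennreal (weight k) * emeasure lborel (dust k \<inter> cbox u (u + \<rho> *\<^sub>R One))
      \<le> ennreal (2 ^ DIM('a) * (\<Theta> powr (real DIM('a) - \<sigma> * p) * \<rho> powr (real DIM('a) - \<sigma> * p)) * x i powr (- (p - 1)))"
  proof (cases "i \<le> k")
    case True
    have "ennreal (weight k) * emeasure lborel (dust k \<inter> cbox u (u + \<rho> *\<^sub>R One))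
      \<le> ennreal (weight k) * ennreal ((2 * (2 ^ (k - i) * l k)) ^ DIM('a))"
      by (intro mult_left_mono emeasure_dust_Int i True) auto
    also have "\<dots> = ennreal (weight k * (2 ^ k * l k) ^ DIM('a) * (2 ^ DIM('a) * (1 / (2 ^ i) ^ DIM('a))))"
      unfolding count_split[OF True] using weight_pos[of k] l_pos[of k]
      by (simp add: mult_ac flip: ennreal_mult)
    also have "\<dots> = ennreal (2 ^ DIM('a) * l i powr (real DIM('a) - \<sigma> * p) * x i powr (- (p - 1)))"
      unfolding weight_mass inverse_count by (simp add: mult_ac)
    also have "\<dots> \<le> ennreal (2 ^ DIM('a) * (\<Theta> powr (real DIM('a) - \<sigma> * p) * \<rho> powr (real DIM('a) - \<sigma> * p)) * x i powr (- (p - 1)))"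
      using li by (intro ennreal_leI mult_right_mono mult_left_mono) auto
    finally show ?thesis .
  next
    case False
    \<comment> \<open>Here the side is at most that of a stage-k cell, so counting gives nothing.
      The full volume of the cube is used, and monotonicity of \<open>weight\<close> carries the
      estimate from stage \<open>k\<close> to stage \<open>i\<close>.\<close>
    have "weight i \<le> \<rho> powr (- (\<sigma> * p)) * x i powr (- (p - 1))"
      unfolding weight_def using i \<rho> p q by (intro mult_right_mono powr_mono2') auto
    hence "weight k \<le> \<rho> powr (- (\<sigma> * p)) * x i powr (- (p - 1))"
      using weight_le[of k i] False by simp
    moreover have "emeasure lborel (dust k \<inter> cbox u (u + \<rho> *\<^sub>R One)) \<le> ennreal (\<rho> ^ DIM('a))"
    proof -
      have "emeasure lborel (dust k \<inter> cbox u (u + \<rho> *\<^sub>R One)) \<le> emeasure lborel (cbox u (u + \<rho> *\<^sub>R One))"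
        by (intro emeasure_mono) auto
      also have "\<dots> = ennreal (\<rho> ^ DIM('a))"
        using \<rho> by (subst emeasure_lborel_cbox) (auto simp: inner_add_left)
      finally show ?thesis .
    qed
    ultimately have "ennreal (weight k) * emeasure lborel (dust k \<inter> cbox u (u + \<rho> *\<^sub>R One)) \<le>
       ennreal (\<rho> powr (- (\<sigma> * p)) * x i powr (- (p - 1))) * ennreal (\<rho> ^ DIM('a))"
      by (intro mult_mono ennreal_leI) auto
    also have "\<dots> = ennreal (1 * 1 * (\<rho> powr real DIM('a) * \<rho> powr (- (\<sigma> * p))) * x i powr (- (p - 1)))"
      using \<rho> by (simp add: powr_realpow mult_ac flip: ennreal_mult)
    also have "\<rho> powr real DIM('a) * \<rho> powr (- (\<sigma> * p)) = \<rho> powr (real DIM('a) - \<sigma> * p)" by (simp flip: powr_add)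
    also have "ennreal (1 * 1 * \<rho> powr (real DIM('a) - \<sigma> * p) * x i powr (- (p - 1))) \<le>
       ennreal (2 ^ DIM('a) * \<Theta> powr (real DIM('a) - \<sigma> * p) * \<rho> powr (real DIM('a) - \<sigma> * p) * x i powr (- (p - 1)))"
      using \<Theta> \<sigma>p by (intro ennreal_leI mult_right_mono mult_mono) (auto intro: ge_one_powr_ge_zero)
    finally show ?thesis by (simp add: mult.assoc)
  qed
  also have "\<dots> \<le> ennreal (2 ^ DIM('a) * (\<Theta> powr (real DIM('a) - \<sigma> * p) * \<rho> powr (real DIM('a) - \<sigma> * p)) * (L powr (p - 1) * \<Lambda> powr (- (p - 1))))"
    by (intro ennreal_leI mult_left_mono xi) auto
  finally show ?thesis by (simp add: \<Lambda>_def mult_ac)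
qed

text \<open>The exact value of the left side has exponent \<sigma> and a stray factor (x_k /
  x_i)^(p-1). Giving up part of the exponent, from \<sigma> down to \<open>q\<close>, absorbs this
  factor through \<open>energy_antimono\<close>.\<close>

lemma mass_energy:
  assumes "i \<le> k"
  shows "(2 ^ k * l k) ^ DIM('a) * (1 / (2 ^ i) ^ DIM('a)) \<le> l k powr (q * p) * l i powr (real DIM('a) - q * p)"
proof -
  have W: "weight k * (l k powr (\<sigma> * p) * x k powr (p - 1)) = 1"
  proof -
    have 1: "l k powr (- (\<sigma> * p)) * l k powr (\<sigma> * p) = 1" "x k powr (- (p - 1)) * x k powr (p - 1) = 1"
      using l_pos[of k] x_ge_1[of k] by (simp_all flip: powr_add)
    have "a * b * (c * d) = (a * c) * (b * d)" for a b c d :: real by (simp add: mult_ac)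
    thus ?thesis unfolding weight_def by (simp only: 1 mult_1)
  qed
  have "(2 ^ k * l k) ^ DIM('a) = l k powr (\<sigma> * p) * x k powr (p - 1)"
  proof -
    have "weight k * (2 ^ k * l k) ^ DIM('a) = weight k * (l k powr (\<sigma> * p) * x k powr (p - 1))"
      unfolding W weight_mass ..
    thus ?thesis using weight_pos[of k] by (simp only: mult_cancel_left) auto
  qed
  also have "l k powr (\<sigma> * p) = l k powr (q * p) * l k powr ((\<sigma> - q) * p)"
    by (simp add: algebra_simps flip: powr_add)
  finally have "(2 ^ k * l k) ^ DIM('a) * (1 / (2 ^ i) ^ DIM('a)) =
     l k powr (q * p) * (l k powr ((\<sigma> - q) * p) * x k powr (p - 1)) * (l i powr (real DIM('a) - \<sigma> * p) * x i powr (- (p - 1)))"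
    by (simp add: inverse_count)
  also have "\<dots> \<le> l k powr (q * p) * (l i powr ((\<sigma> - q) * p) * x i powr (p - 1)) * (l i powr (real DIM('a) - \<sigma> * p) * x i powr (- (p - 1)))"
    by (intro mult_right_mono mult_left_mono energy_le assms) auto
  also have "\<dots> = l k powr (q * p) * (l i powr ((\<sigma> - q) * p) * l i powr (real DIM('a) - \<sigma> * p)) * (x i powr (p - 1) * x i powr (- (p - 1)))"
    by (simp add: mult_ac)
  also have "x i powr (p - 1) * x i powr (- (p - 1)) = 1" using x_ge_1[of i] by (simp flip: powr_add)
  also have "l i powr ((\<sigma> - q) * p) * l i powr (real DIM('a) - \<sigma> * p) = l i powr (real DIM('a) - q * p)"
    by (simp add: algebra_simps flip: powr_add)
  finally show ?thesis by simp
qed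

text \<open>This provides the density hypothesis of \<open>riesz_trace\<close> at scale l_k, with
  \<open>M\<close> independent of \<open>k\<close>. Small radii use the volume of the ball,
  intermediate ones a count of cells, and radii beyond l_0/2 the total measure of the dust.\<close>

lemma dust_ball_bound:
  fixes y :: 'a
  assumes \<rho>: "\<rho> > 0"
  defines "M \<equiv> unit_ball_vol (real DIM('a)) + 2 ^ DIM('a) * (2 * \<Theta>) powr (real DIM('a) - q * p)"
  shows "emeasure lborel (dust k \<inter> cball y \<rho>) \<le> ennreal (M * \<rho> ^ DIM('a) * (min 1 ((l k / \<rho>) powr q)) powr p)"
proof (cases "\<rho> \<le> l k")
  case True
  have "emeasure lborel (dust k \<inter> cball y \<rho>) \<le> emeasure lborel (cball y \<rho>)"
    by (intro emeasure_mono) auto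
  also have "\<dots> = ennreal (unit_ball_vol (real DIM('a)) * \<rho> ^ DIM('a))" using \<rho> by (simp add: emeasure_cball)
  also have "\<dots> \<le> ennreal (M * \<rho> ^ DIM('a))"
    using \<rho> by (intro ennreal_leI mult_right_mono) (auto simp: M_def)
  also have "M * \<rho> ^ DIM('a) = M * \<rho> ^ DIM('a) * (min 1 ((l k / \<rho>) powr q)) powr p"
  proof -
    have "(l k / \<rho>) powr q \<ge> 1" using True \<rho> q by (intro ge_one_powr_ge_zero) auto
    thus ?thesis by simp
  qed
  finally show ?thesis .
next
  case False
  have qp: "q * p < real DIM('a)"
  proof -
    have "q * p < \<sigma> * p" using q p by (intro mult_strict_right_mono) auto
    thus ?thesis using \<sigma>p by simp
  qed
  have bound: "emeasure lborel (dust k \<inter> cball y \<rho>) \<le> ennreal (2 ^ DIM('a) * (l k powr (q * p) * (2 * \<Theta> * \<rho>) powr (real DIM('a) - q * p)))"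
  proof (cases "2 * \<rho> \<le> l 0")
    case True
    from scale_exists[OF _ True] \<rho> obtain i where i: "l (Suc i) < 2 * \<rho>" "2 * \<rho> \<le> l i" by auto
    \<comment> \<open>Otherwise 2\<rho> \<le> l_i \<le> l_k < \<rho>.\<close>
    have ik: "i \<le> k" using i False \<rho> l_mono[of k i] by (cases "i \<le> k") auto
    have "l i \<le> \<Theta> * l (Suc i)" by (rule \<Theta>)
    also have "\<dots> \<le> \<Theta> * (2 * \<rho>)" using i \<Theta> by (intro mult_left_mono) auto
    finally have li: "l i powr (real DIM('a) - q * p) \<le> (2 * \<Theta> * \<rho>) powr (real DIM('a) - q * p)"
      using qp l_pos[of i] by (intro powr_mono2) auto
    have "cball y \<rho> \<subseteq> cbox (y - \<rho> *\<^sub>R One) (y - \<rho> *\<^sub>R One + (2 * \<rho>) *\<^sub>R One)"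
    proof
      fix z assume "z \<in> cball y \<rho>"
      hence "norm (z - y) \<le> \<rho>" by (simp add: dist_norm norm_minus_commute)
      hence "\<bar>(z - y) \<bullet> b\<bar> \<le> \<rho>" if "b \<in> Basis" for b using Basis_le_norm[OF that, of "z - y"] by linarith
      thus "z \<in> cbox (y - \<rho> *\<^sub>R One) (y - \<rho> *\<^sub>R One + (2 * \<rho>) *\<^sub>R One)"
        by (fastforce simp: mem_box inner_diff_left inner_add_left abs_le_iff)
    qed
    hence "emeasure lborel (dust k \<inter> cball y \<rho>) \<le>
       emeasure lborel (dust k \<inter> cbox (y - \<rho> *\<^sub>R One) (y - \<rho> *\<^sub>R One + (2 * \<rho>) *\<^sub>R One))"
      by (intro emeasure_mono) auto
    also have "\<dots> \<le> ennreal ((2 * (2 ^ (k - i) * l k)) ^ DIM('a))"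
      by (intro emeasure_dust_Int i ik)
    also have "\<dots> \<le> ennreal (2 ^ DIM('a) * (l k powr (q * p) * (2 * \<Theta> * \<rho>) powr (real DIM('a) - q * p)))"
      unfolding count_split[OF ik]
      by (intro ennreal_leI mult_left_mono order.trans[OF mass_energy[OF ik]] li) auto
    finally show ?thesis .
  next
    case False
    have "l 0 \<le> 1 * (2 * \<rho>)" using False by simp
    also have "\<dots> \<le> \<Theta> * (2 * \<rho>)" using \<Theta> \<rho> by (intro mult_right_mono) auto
    finally have li: "l 0 powr (real DIM('a) - q * p) \<le> (2 * \<Theta> * \<rho>) powr (real DIM('a) - q * p)"
      using qp l_pos[of 0] by (intro powr_mono2) auto
    have "emeasure lborel (dust k \<inter> cball y \<rho>) \<le> emeasure lborel (dust k :: 'a set)"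
      by (intro emeasure_mono) auto
    also have "\<dots> = ennreal ((2 ^ k * l k) ^ DIM('a) * (1 / (2 ^ 0) ^ DIM('a)))" by (simp add: emeasure_dust)
    also have "\<dots> \<le> ennreal (1 * (l k powr (q * p) * (2 * \<Theta> * \<rho>) powr (real DIM('a) - q * p)))"
      unfolding mult_1 by (intro ennreal_leI order.trans[OF mass_energy[of 0 k] mult_left_mono[OF li]]) auto
    also have "\<dots> \<le> ennreal (2 ^ DIM('a) * (l k powr (q * p) * (2 * \<Theta> * \<rho>) powr (real DIM('a) - q * p)))"
      by (intro ennreal_leI mult_right_mono) auto
    finally show ?thesis .
  qed
  have "l k powr (q * p) * (2 * \<Theta> * \<rho>) powr (real DIM('a) - q * p) = (2 * \<Theta>) powr (real DIM('a) - q * p) * (\<rho> powr real DIM('a) * (l k powr (q * p) * \<rho> powr (- (q * p))))"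
    using \<rho> \<Theta> by (simp add: powr_mult powr_diff powr_minus divide_inverse)
  also have "l k powr (q * p) * \<rho> powr (- (q * p)) = (l k / \<rho>) powr (q * p)"
    using \<rho> l_pos[of k] by (subst powr_divide) (auto simp: powr_minus divide_inverse)
  also have "\<rho> powr real DIM('a) = \<rho> ^ DIM('a)" using \<rho> by (simp add: powr_realpow)
  also have "(l k / \<rho>) powr (q * p) = (min 1 ((l k / \<rho>) powr q)) powr p"
  proof -
    have "(l k / \<rho>) powr q \<le> 1" using False \<rho> q l_pos[of k] by (intro powr_le1) auto
    thus ?thesis by (simp add: powr_powr)
  qed
  finally have "2 ^ DIM('a) * (l k powr (q * p) * (2 * \<Theta> * \<rho>) powr (real DIM('a) - q * p)) =
     2 ^ DIM('a) * (2 * \<Theta>) powr (real DIM('a) - q * p) * (\<rho> ^ DIM('a) * (min 1 ((l k / \<rho>) powr q)) powr p)" by simp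
  also have "\<dots> \<le> M * (\<rho> ^ DIM('a) * (min 1 ((l k / \<rho>) powr q)) powr p)"
    using \<rho> by (intro mult_right_mono) (auto simp: M_def)
  finally have "ennreal (2 ^ DIM('a) * (l k powr (q * p) * (2 * \<Theta> * \<rho>) powr (real DIM('a) - q * p)))
     \<le> ennreal (M * \<rho> ^ DIM('a) * (min 1 ((l k / \<rho>) powr q)) powr p)"
    by (intro ennreal_leI) (simp only: mult.assoc)
  with bound show ?thesis by (rule order.trans)
qed

end

section \<open>Potentials and membership in the function spaces\<close>

text \<open>The trace inequality is applied to a large ball with q = n/p: then (l/\<rho>)^(qp) =
  (l/\<rho>)^n, so the density condition holds by comparing volumes, and s < q is exactly s p < n.
  Integrability over balls of every radius gives finiteness almost everywhere.\<close>

lemma bessel_potential_finite: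
  fixes s p :: real and h :: "'a::euclidean_space \<Rightarrow> real"
  assumes s: "0 < s" "s * p < real DIM('a)" and p: "1 < p"
    and h[measurable]: "h \<in> borel_measurable borel" and h0: "\<And>x. h x \<ge> 0"
    and D: "(\<integral>\<^sup>+y. ennreal (\<bar>h y\<bar> powr p) \<partial>lborel) < \<infinity>"
  shows "AE x in lborel. integrable lborel (\<lambda>y. bessel_kernel s (x - y) * h y) \<and>
     ennreal (\<integral>y. bessel_kernel s (x - y) * h y \<partial>lborel) =
       (\<integral>\<^sup>+y. ennreal (bessel_kernel s (x - y)) * ennreal (h y) \<partial>lborel)"
proof -
  define n where "n = real DIM('a)"
  define q where "q = n / p"
  define U where "U = unit_ball_vol n"
  define D' where "D' = enn2real (\<integral>\<^sup>+y. ennreal (\<bar>h y\<bar> powr p) \<partial>lborel)"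
  have D': "D' \<ge> 0" "(\<integral>\<^sup>+y. ennreal (\<bar>h y\<bar> powr p) \<partial>lborel) \<le> ennreal D'"
    using D by (auto simp: D'_def ennreal_enn2real_if)
  have n: "n > 0" by (simp add: n_def)
  have sq: "s < q" using s p by (simp add: q_def n_def field_simps)
  have "s * 1 < s * p" using s p by (intro mult_strict_left_mono) auto
  hence sn: "s < real DIM('a)" using s by linarith
  have U: "U \<ge> 0" by (simp add: U_def n_def)
  obtain C where C: "C > 0" "\<And>x :: 'a. x \<noteq> 0 \<Longrightarrow> bessel_kernel s x \<le> C * norm x powr (s - n)"
    using bessel_kernel_upper[OF s(1) sn] unfolding n_def by blast
  define C' where "C' = riesz_trace_const (real DIM('a)) s q U"
  define I where "I x = (\<integral>\<^sup>+y. ennreal (norm (x - y) powr (s - n)) * ennreal \<bar>h y\<bar> \<partial>lborel)" for x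
  have I[measurable]: "I \<in> borel_measurable borel" unfolding I_def by measurable
  have "AE x in lborel. x \<in> cball 0 (Suc R) \<longrightarrow> I x < \<infinity>" for R :: nat
  proof -
    define F where "F = cball (0::'a) (Suc R)"
    have F: "F \<in> sets borel" "emeasure lborel F < \<infinity>" "measure lborel F > 0"
      by (auto simp: F_def emeasure_cball ennreal_mult_less_top)
    have ball: "emeasure lborel (F \<inter> cball y \<rho>) \<le> ennreal (U * \<rho> ^ DIM('a) * (min 1 ((Suc R / \<rho>) powr q)) powr p)"
      if \<rho>: "\<rho> > 0" for y :: 'a and \<rho> :: real
    proof (cases "\<rho> \<le> Suc R")
      case True
      have "emeasure lborel (F \<inter> cball y \<rho>) \<le> emeasure lborel (cball y \<rho>)"
        by (intro emeasure_mono) auto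
      moreover have "(Suc R / \<rho>) powr q \<ge> 1" using True \<rho> sq s by (intro ge_one_powr_ge_zero) auto
      ultimately show ?thesis using \<rho> by (simp add: emeasure_cball U_def n_def)
    next
      case False
      have "emeasure lborel (F \<inter> cball y \<rho>) \<le> emeasure lborel F"
        using F(1) by (intro emeasure_mono) auto
      also have "\<dots> = ennreal (U * Suc R ^ DIM('a))" by (simp add: emeasure_cball F_def U_def n_def)
      also have "U * Suc R ^ DIM('a) = U * \<rho> ^ DIM('a) * (Suc R / \<rho>) powr n"
        using \<rho> by (simp add: n_def powr_realpow power_divide)
      also have "(Suc R / \<rho>) powr n = (min 1 ((Suc R / \<rho>) powr q)) powr p"
      proof -
        have "(Suc R / \<rho>) powr q \<le> 1" using False \<rho> sq s by (intro powr_le1) auto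
        thus ?thesis using p by (simp add: powr_powr q_def)
      qed
      finally show ?thesis .
    qed
    have "(\<integral>\<^sup>+x. I x * indicator F x \<partial>lborel)
        \<le> ennreal (C' * (1 + D') * (real (Suc R) powr s * measure lborel F powr (1 - 1 / p)))"
      unfolding I_def n_def C'_def by (rule riesz_trace[OF s(1) sq sn p U F _ ball h D']) simp
    also have "\<dots> < \<infinity>" by simp
    finally have "(\<integral>\<^sup>+x. I x * indicator F x \<partial>lborel) < \<infinity>" .
    hence "AE x in lborel. I x * indicator F x \<noteq> \<infinity>"
      using F(1) by (intro nn_integral_PInf_AE) auto
    thus ?thesis
      by eventually_elim (auto simp: F_def less_top indicator_def)
  qed
  hence "AE x in lborel. \<forall>R::nat. x \<in> cball 0 (Suc R) \<longrightarrow> I x < \<infinity>"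
    unfolding AE_all_countable by blast
  thus ?thesis
  proof eventually_elim
    case (elim x)
    obtain R :: nat where "norm x \<le> R" using real_arch_simple by blast
    hence Ix: "I x < \<infinity>" using elim[rule_format, of R] by simp
    have "(\<integral>\<^sup>+y. ennreal (bessel_kernel s (x - y) * h y) \<partial>lborel) \<le> (\<integral>\<^sup>+y. ennreal C * (ennreal (norm (x - y) powr (s - n)) * ennreal \<bar>h y\<bar>) \<partial>lborel)"
    proof (rule nn_integral_mono_AE)
      show "AE y in lborel. ennreal (bessel_kernel s (x - y) * h y) \<le> ennreal C * (ennreal (norm (x - y) powr (s - n)) * ennreal \<bar>h y\<bar>)"
        using AE_lborel_singleton[of x]
      proof eventually_elim
        case (elim y)
        have "bessel_kernel s (x - y) * h y \<le> C * norm (x - y) powr (s - n) * h y"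
          using C(2)[of "x - y"] elim h0 by (intro mult_right_mono) auto
        thus ?case using C(1) h0[of y] by (simp add: ennreal_mult[symmetric] mult.assoc ennreal_leI)
      qed
    qed
    also have "\<dots> = ennreal C * I x" unfolding I_def by (rule nn_integral_cmult) measurable
    also have "\<dots> < \<infinity>" using Ix by (simp add: ennreal_mult_less_top)
    finally have fin: "(\<integral>\<^sup>+y. ennreal (bessel_kernel s (x - y) * h y) \<partial>lborel) < \<infinity>" .
    have nonneg: "bessel_kernel s (x - y) * h y \<ge> 0" for y
      by (simp add: h0 bessel_kernel_nonneg[OF s(1)])
    have int: "integrable lborel (\<lambda>y. bessel_kernel s (x - y) * h y)"
      using fin nonneg by (intro integrableI_nonneg) auto
    have "ennreal (\<integral>y. bessel_kernel s (x - y) * h y \<partial>lborel) = (\<integral>\<^sup>+y. ennreal (bessel_kernel s (x - y) * h y) \<partial>lborel)"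
      using int nonneg by (intro nn_integral_eq_integral[symmetric]) auto
    also have "\<dots> = (\<integral>\<^sup>+y. ennreal (bessel_kernel s (x - y)) * ennreal (h y) \<partial>lborel)"
      by (simp add: h0 bessel_kernel_nonneg[OF s(1)] ennreal_mult)
    finally show ?case using int by blast
  qed
qed

section \<open>From size bounds on cubes to membership in \<open>M_space\<close>\<close>

lemma powr_abs_diff_le:
  fixes a b p :: real
  assumes "p > 0"
  shows "\<bar>a - b\<bar> powr p \<le> 2 powr p * (\<bar>a\<bar> powr p + \<bar>b\<bar> powr p)"
proof -
  have "\<bar>a - b\<bar> powr p \<le> (2 * max \<bar>a\<bar> \<bar>b\<bar>) powr p" using assms by (intro powr_mono2) auto
  also have "\<dots> = 2 powr p * max \<bar>a\<bar> \<bar>b\<bar> powr p" by (simp add: powr_mult)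
  also have "\<dots> \<le> 2 powr p * (\<bar>a\<bar> powr p + \<bar>b\<bar> powr p)"
    by (intro mult_left_mono) (auto simp: max_def)
  finally show ?thesis .
qed

lemma integrable_of_powr:
  fixes h :: "'a::euclidean_space \<Rightarrow> real"
  assumes [measurable]: "h \<in> borel_measurable borel" and "(\<integral>\<^sup>+x. ennreal (\<bar>h x\<bar> powr p) \<partial>lborel) < \<infinity>"
  shows "integrable lborel (\<lambda>x. \<bar>h x\<bar> powr p)"
  using assms(2) by (intro integrableI_nonneg) auto

text \<open>Oscillation is controlled by size alone, with no cancellation. At the threshold m =
  (B/V)^(1/p) both terms of the Young bound for the average are at most m V, hence the factor
  2.\<close>

lemma cube_oscillation:
  fixes h :: "'a::euclidean_space \<Rightarrow> real" and p B V :: real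
  assumes p: "p > 1" and h[measurable]: "h \<in> borel_measurable borel"
    and fin: "(\<integral>\<^sup>+x. ennreal (\<bar>h x\<bar> powr p) \<partial>lborel) < \<infinity>"
    and Q[measurable]: "Q \<in> sets borel" and V: "V > 0" "emeasure lborel Q = ennreal V"
    and B: "B > 0" "(\<integral>\<^sup>+x\<in>Q. ennreal (\<bar>h x\<bar> powr p) \<partial>lborel) \<le> ennreal B"
  shows "set_integrable lborel Q h"
    and "\<bar>cube_avg h Q\<bar> \<le> 2 * (B / V) powr (1 / p)"
    and "set_integrable lborel Q (\<lambda>x. \<bar>h x - cube_avg h Q\<bar> powr p)"
    and "(LINT x:Q|lborel. \<bar>h x - cube_avg h Q\<bar> powr p) \<le> 2 powr p * (1 + 2 powr p) * B"
proof -
  have mQ: "measure lborel Q = V" using V by (simp add: measure_def)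
  have one: "integrable lborel (indicat_real Q)"
    using V by (intro integrable_real_indicator) auto
  have ip: "integrable lborel (\<lambda>x. indicator Q x * \<bar>h x\<bar> powr p)"
    using integrable_mult_indicator[OF _ integrable_of_powr[OF h fin], of Q] by simp
  have B': "(\<integral>x. indicator Q x * \<bar>h x\<bar> powr p \<partial>lborel) \<le> B"
  proof -
    have "ennreal (\<integral>x. indicator Q x * \<bar>h x\<bar> powr p \<partial>lborel) = (\<integral>\<^sup>+x. ennreal (indicator Q x * \<bar>h x\<bar> powr p) \<partial>lborel)"
      by (rule nn_integral_eq_integral[symmetric, OF ip]) auto
    also have "\<dots> = (\<integral>\<^sup>+x\<in>Q. ennreal (\<bar>h x\<bar> powr p) \<partial>lborel)"
      by (intro nn_integral_cong) (auto simp: indicator_def)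
    also note B(2)
    finally show ?thesis using B(1) by (subst (asm) ennreal_le_iff) auto
  qed
  define m where "m = (B / V) powr (1 / p)"
  have m: "m > 0" using B V by (simp add: m_def)
  have young: "\<bar>indicator Q x * h x\<bar> \<le> m powr (1 - p) * (indicator Q x * \<bar>h x\<bar> powr p) + indicator Q x * m" for x
    using abs_le_young[OF m p, of "h x"] by (auto simp: indicator_def)
  have ih: "integrable lborel (\<lambda>x. indicator Q x * h x)"
    by (rule Bochner_Integration.integrable_bound[of _ "\<lambda>x. m powr (1 - p) * (indicator Q x * \<bar>h x\<bar> powr p) + indicator Q x * m"])
      (use ip one m young in \<open>auto intro!: AE_I2\<close>)
  thus "set_integrable lborel Q h" by (simp add: set_integrable_def)
  have mm: "m powr (1 - p) * B = m * V"
  proof -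
    have "m powr (- p) = V / B"
      using B V p by (simp add: m_def powr_powr powr_minus field_simps)
    moreover have "m powr (1 - p) = m * m powr (- p)" using m powr_add[of m 1 "- p"] by simp
    ultimately show ?thesis using B by simp
  qed
  have "\<bar>\<integral>x. indicator Q x * h x \<partial>lborel\<bar> \<le> (\<integral>x. \<bar>indicator Q x * h x\<bar> \<partial>lborel)"
    using integral_norm_bound[of lborel "\<lambda>x. indicator Q x * h x"] by simp
  also have "\<dots> \<le> (\<integral>x. m powr (1 - p) * (indicator Q x * \<bar>h x\<bar> powr p) + indicator Q x * m \<partial>lborel)"
    using ih ip one young by (intro integral_mono) auto
  also have "\<dots> = m powr (1 - p) * (\<integral>x. indicator Q x * \<bar>h x\<bar> powr p \<partial>lborel) + V * m"
    using ip one mQ by simp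
  also have "\<dots> \<le> m powr (1 - p) * B + V * m"
    by (intro add_right_mono mult_left_mono B') auto
  also have "\<dots> = 2 * m * V" by (simp add: mm)
  finally show avg: "\<bar>cube_avg h Q\<bar> \<le> 2 * (B / V) powr (1 / p)"
    using V by (simp add: cube_avg_def set_lebesgue_integral_def mQ m_def abs_mult field_simps)
  define a where "a = cube_avg h Q"
  have ap: "\<bar>a\<bar> powr p \<le> 2 powr p * (B / V)"
  proof -
    have "\<bar>a\<bar> powr p \<le> (2 * (B / V) powr (1 / p)) powr p"
      using avg p by (intro powr_mono2) (auto simp: a_def)
    also have "\<dots> = 2 powr p * (B / V)" using B V p by (simp add: powr_mult powr_powr)
    finally show ?thesis .
  qed
  have osc: "indicator Q x * \<bar>h x - a\<bar> powr p \<le>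
      2 powr p * (indicator Q x * \<bar>h x\<bar> powr p) + indicator Q x * (2 powr p * \<bar>a\<bar> powr p)" for x
    using powr_abs_diff_le[of p "h x" a] p by (auto simp: indicator_def distrib_left)
  have io: "integrable lborel (\<lambda>x. indicator Q x * \<bar>h x - a\<bar> powr p)"
    by (rule Bochner_Integration.integrable_bound[of _ "\<lambda>x. 2 powr p * (indicator Q x * \<bar>h x\<bar> powr p) + indicator Q x * (2 powr p * \<bar>a\<bar> powr p)"])
      (use ip one osc in \<open>auto intro!: AE_I2\<close>)
  thus "set_integrable lborel Q (\<lambda>x. \<bar>h x - cube_avg h Q\<bar> powr p)"
    by (simp add: set_integrable_def a_def)
  have "(\<integral>x. indicator Q x * \<bar>h x - a\<bar> powr p \<partial>lborel) \<le>
     (\<integral>x. 2 powr p * (indicator Q x * \<bar>h x\<bar> powr p) + indicator Q x * (2 powr p * \<bar>a\<bar> powr p) \<partial>lborel)"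
    using io ip one osc by (intro integral_mono) auto
  also have "\<dots> = 2 powr p * (\<integral>x. indicator Q x * \<bar>h x\<bar> powr p \<partial>lborel) + V * (2 powr p * \<bar>a\<bar> powr p)"
    using ip one mQ by simp
  also have "\<dots> \<le> 2 powr p * B + V * (2 powr p * (2 powr p * (B / V)))"
    using V by (intro add_mono mult_left_mono B' ap) auto
  also have "\<dots> = 2 powr p * (1 + 2 powr p) * B" using V by (simp add: algebra_simps)
  finally show "(LINT x:Q|lborel. \<bar>h x - cube_avg h Q\<bar> powr p) \<le> 2 powr p * (1 + 2 powr p) * B"
    by (simp add: set_lebesgue_integral_def a_def)
qed

text \<open>It suffices to bound the integral of |h|^p itself at the endpoint exponent: 1 - log 2
  |Q| is at least 1, so its power -(p-1) is dominated by the power -p\<tau>. With |Q| = \<rho>^n,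
  the power of |Q| in \<open>M_space\<close> is \<rho>^(n-(t+r)p).\<close>

lemma M_spaceI:
  fixes h f :: "'a::euclidean_space \<Rightarrow> real" and t r p \<tau> C :: real
  assumes p: "p > 1" and \<tau>: "p * \<tau> \<le> p - 1" and C: "C > 0"
    and h[measurable]: "h \<in> borel_measurable borel" and f: "bessel_pot t h f"
    and fin: "(\<integral>\<^sup>+x. ennreal (\<bar>h x\<bar> powr p) \<partial>lborel) < \<infinity>"
    and cube: "\<And>u \<rho>. 0 < \<rho> \<Longrightarrow> \<rho> \<le> 1 \<Longrightarrow> (\<integral>\<^sup>+x\<in>cbox u (u + \<rho> *\<^sub>R One). ennreal (\<bar>h x\<bar> powr p) \<partial>lborel)
       \<le> ennreal (C * (\<rho> powr (real DIM('a) - (t + r) * p) * (1 - log 2 (\<rho> ^ DIM('a))) powr (- (p - 1))))"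
  shows "f \<in> M_space t \<tau> r p"
proof -
  define n where "n = real DIM('a)"
  have n: "n > 0" by (simp add: n_def)
  \<comment> \<open>The first summand serves the averages over unit cubes, where the logarithmic
    factor equals 1, and the second the oscillation integrals.\<close>
  define K where "K = 2 * C powr (1 / p) + 2 powr p * (1 + 2 powr p) * C"
  have em: "emeasure lborel (cbox u (u + \<rho> *\<^sub>R One)) = ennreal (\<rho> ^ DIM('a))" if "\<rho> > 0" for u :: 'a and \<rho>
    using that by (subst emeasure_lborel_cbox) (auto simp: inner_add_left)
  have int: "set_integrable lborel Q h" if "is_cube Q" for Q
  proof -
    from that obtain u \<rho> where Q: "Q = cbox u (u + \<rho> *\<^sub>R One)" "\<rho> > 0" by (auto simp: is_cube_def)
    \<comment> \<open>The added 1 keeps the bound positive even if \<open>h\<close> vanishes almost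
      everywhere.\<close>
    define B where "B = enn2real (\<integral>\<^sup>+x. ennreal (\<bar>h x\<bar> powr p) \<partial>lborel) + 1"
    have "(\<integral>\<^sup>+x\<in>Q. ennreal (\<bar>h x\<bar> powr p) \<partial>lborel) \<le> (\<integral>\<^sup>+x. ennreal (\<bar>h x\<bar> powr p) \<partial>lborel)"
      by (intro nn_integral_mono) (auto simp: indicator_def)
    also have "\<dots> = ennreal (enn2real (\<integral>\<^sup>+x. ennreal (\<bar>h x\<bar> powr p) \<partial>lborel))"
      using fin by simp
    also have "\<dots> \<le> ennreal B" by (intro ennreal_leI) (simp add: B_def)
    finally show ?thesis
      using cube_oscillation(1)[OF p h fin, of Q "\<rho> ^ DIM('a)" B] Q em[of \<rho> u]
      by (simp add: B_def add_nonneg_pos)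
  qed
  have small: "\<bar>cube_avg h Q\<bar> \<le> 2 * (C * \<rho> powr (- ((t + r) * p)) * (1 - log 2 (\<rho> ^ DIM('a))) powr (- (p - 1))) powr (1 / p) \<and>
      set_integrable lborel Q (\<lambda>x. \<bar>h x - cube_avg h Q\<bar> powr p) \<and>
      (LINT x:Q|lborel. \<bar>h x - cube_avg h Q\<bar> powr p) \<le> K * (1 - log 2 (measure lborel Q)) powr (- p * \<tau>)
                    * (measure lborel Q) powr (1 - p * (r + t) / real DIM('a))"
    if Q: "Q = cbox u (u + \<rho> *\<^sub>R One)" "0 < \<rho>" "\<rho> \<le> 1" for Q \<rho> and u :: 'a
  proof -
    define V where "V = \<rho> ^ DIM('a)"
    have V: "V > 0" "V \<le> 1" using Q by (auto simp: V_def power_le_one)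
    have V': "V = \<rho> powr n" using Q by (simp add: V_def n_def powr_realpow)
    have mV: "emeasure lborel Q = ennreal V" "measure lborel Q = V"
      using em Q V by (simp_all add: V_def measure_def)
    have lV: "1 - log 2 V \<ge> 1" using V by simp
    define B where "B = C * (\<rho> powr (n - (t + r) * p) * (1 - log 2 V) powr (- (p - 1)))"
    have "B > 0" unfolding B_def using C Q lV by (intro mult_pos_pos) auto
    note osc = cube_oscillation[OF p h fin _ V(1) mV(1) this]
    have "(\<integral>\<^sup>+x\<in>Q. ennreal (\<bar>h x\<bar> powr p) \<partial>lborel) \<le> ennreal B"
      using cube[OF Q(2,3), of u] by (simp add: B_def Q(1) V_def n_def)
    note osc = osc[OF _ this]
    have Qb: "Q \<in> sets borel" by (simp add: Q(1))
    have BV: "B / V = C * \<rho> powr (- ((t + r) * p)) * (1 - log 2 V) powr (- (p - 1))"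
    proof -
      have "\<rho> powr (n - (t + r) * p) = V * \<rho> powr (- ((t + r) * p))"
        unfolding V' by (simp flip: powr_add)
      thus ?thesis using V by (simp add: B_def)
    qed
    have "B \<le> C * (\<rho> powr (n - (t + r) * p) * (1 - log 2 V) powr (- p * \<tau>))"
      unfolding B_def using C lV \<tau> by (intro mult_left_mono powr_mono) auto
    also have "\<rho> powr (n - (t + r) * p) = V powr (1 - p * (r + t) / n)"
    proof -
      have "n * (1 - p * (r + t) / n) = n - (t + r) * p" using n by (simp add: field_simps)
      thus ?thesis unfolding V' powr_powr by simp
    qed
    finally have "2 powr p * (1 + 2 powr p) * B \<le>
       2 powr p * (1 + 2 powr p) * (C * (V powr (1 - p * (r + t) / n) * (1 - log 2 V) powr (- p * \<tau>)))"
      by (rule mult_left_mono) simp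
    also have "2 powr p * (1 + 2 powr p) * (C * (V powr (1 - p * (r + t) / n) * (1 - log 2 V) powr (- p * \<tau>))) =
       2 powr p * (1 + 2 powr p) * C * ((1 - log 2 V) powr (- p * \<tau>) * V powr (1 - p * (r + t) / n))"
      by (simp add: mult_ac)
    also have "\<dots> \<le> K * ((1 - log 2 V) powr (- p * \<tau>) * V powr (1 - p * (r + t) / n))"
      unfolding K_def by (intro mult_right_mono) auto
    finally have "(LINT x:Q|lborel. \<bar>h x - cube_avg h Q\<bar> powr p) \<le>
       K * ((1 - log 2 V) powr (- p * \<tau>) * V powr (1 - p * (r + t) / n))"
      using osc(4)[OF Qb] by linarith
    thus ?thesis using osc(2,3)[OF Qb] unfolding BV mV(2) V_def[symmetric] n_def[symmetric] by (simp only: mult.assoc)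
  qed
  have side: "\<rho> \<le> 1" if "\<rho> ^ DIM('a) \<le> 1" for \<rho> :: real
  proof (rule ccontr)
    assume "\<not> \<rho> \<le> 1"
    hence "1 < \<rho> ^ DIM('a)" by (intro one_less_power) auto
    with that show False by simp
  qed
  have side1: "\<rho> = 1" if "\<rho> ^ DIM('a) = 1" "\<rho> > 0" for \<rho> :: real
    using that power_eq_iff_eq_base[of "DIM('a)" \<rho> 1] by simp
  have meas: "measure lborel (cbox u (u + \<rho> *\<^sub>R One)) = \<rho> ^ DIM('a)" if "\<rho> > 0" for u :: 'a and \<rho>
    using em[OF that] that by (simp add: measure_def)
  have unit: "\<bar>cube_avg h Q\<bar> \<le> K" if Q: "is_cube Q" "measure lborel Q = 1" for Q
  proof -
    from Q(1) obtain u \<rho> where u: "Q = cbox u (u + \<rho> *\<^sub>R One)" "\<rho> > 0" by (auto simp: is_cube_def)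
    have \<rho>1: "\<rho> = 1" using Q(2) u(2) unfolding u(1) meas[OF u(2)] by (rule side1)
    have "\<bar>cube_avg h Q\<bar> \<le> 2 * (C * \<rho> powr (- ((t + r) * p)) * (1 - log 2 (\<rho> ^ DIM('a))) powr (- (p - 1))) powr (1 / p)"
      using small[OF u eq_refl[OF \<rho>1]] by (rule conjunct1)
    also have "\<dots> = 2 * C powr (1 / p)" by (simp add: \<rho>1)
    also have "\<dots> \<le> K" using C by (simp add: K_def)
    finally show ?thesis .
  qed
  have "set_integrable lborel Q (\<lambda>x. \<bar>h x - cube_avg h Q\<bar> powr p) \<and>
      (LINT x:Q|lborel. \<bar>h x - cube_avg h Q\<bar> powr p) \<le> K * (1 - log 2 (measure lborel Q)) powr (- p * \<tau>)
                    * (measure lborel Q) powr (1 - p * (r + t) / real DIM('a))"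
    if Q: "is_cube Q" "measure lborel Q \<le> 1" for Q
  proof -
    from Q(1) obtain u \<rho> where u: "Q = cbox u (u + \<rho> *\<^sub>R One)" "\<rho> > 0" by (auto simp: is_cube_def)
    have "\<rho> \<le> 1" using Q(2) unfolding u(1) meas[OF u(2)] by (rule side)
    from small[OF u this] show ?thesis by (rule conjunct2)
  qed
  hence osc: "\<forall>Q. is_cube Q \<and> measure lborel Q \<le> 1 \<longrightarrow>
      set_integrable lborel Q (\<lambda>x. \<bar>h x - cube_avg h Q\<bar> powr p) \<and>
      (LINT x:Q|lborel. \<bar>h x - cube_avg h Q\<bar> powr p) \<le> K * (1 - log 2 (measure lborel Q)) powr (- p * \<tau>)
                    * (measure lborel Q) powr (1 - p * (r + t) / real DIM('a))" by blast
  show ?thesis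
    unfolding M_space_def mem_Collect_eq
  proof (intro exI[of _ h] conjI)
    show "h \<in> borel_measurable lborel" by simp
    show "bessel_pot t h f" by (rule f)
    show "\<forall>Q. is_cube Q \<longrightarrow> set_integrable lborel Q h" using int by simp
    show "\<exists>C. (\<forall>Q. is_cube Q \<and> measure lborel Q = 1 \<longrightarrow> \<bar>cube_avg h Q\<bar> \<le> C) \<and>
      (\<forall>Q. is_cube Q \<and> measure lborel Q \<le> 1 \<longrightarrow>
        set_integrable lborel Q (\<lambda>x. \<bar>h x - cube_avg h Q\<bar> powr p) \<and>
        (LINT x:Q|lborel. \<bar>h x - cube_avg h Q\<bar> powr p) \<le> C * (1 - log 2 (measure lborel Q)) powr (- p * \<tau>)
                    * (measure lborel Q) powr (1 - p * (r + t) / real DIM('a)))"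
      by (rule exI[of _ K], rule conjI[OF _ osc]) (simp add: unit)
  qed
qed

text \<open>The constant in \<open>X_space\<close> comes without a sign; the absolute value makes
  its p-th power usable directly.\<close>

lemma H_norm_leE:
  assumes "H_norm_le s p g C" "p > 0"
  obtains k where "k \<in> borel_measurable borel" "bessel_pot s k g"
    "(\<integral>\<^sup>+y. ennreal (\<bar>k y\<bar> powr p) \<partial>lborel) \<le> ennreal (\<bar>C\<bar> powr p)"
proof -
  from assms(1) obtain k where k: "k \<in> borel_measurable lborel" "integrable lborel (\<lambda>x. \<bar>k x\<bar> powr p)"
    "(\<integral>x. \<bar>k x\<bar> powr p \<partial>lborel) powr (1 / p) \<le> C" "bessel_pot s k g"
    unfolding H_norm_le_def by blast
  define I where "I = (\<integral>x. \<bar>k x\<bar> powr p \<partial>lborel)"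
  have I: "I \<ge> 0" by (simp add: I_def)
  have "I = (I powr (1 / p)) powr p" using I assms(2) by (simp add: powr_powr)
  also have "\<dots> \<le> \<bar>C\<bar> powr p" using k(3) assms(2) by (intro powr_mono2) (auto simp: I_def)
  finally have "ennreal I \<le> ennreal (\<bar>C\<bar> powr p)" by (rule ennreal_leI)
  moreover have "(\<integral>\<^sup>+y. ennreal (\<bar>k y\<bar> powr p) \<partial>lborel) = ennreal I"
    unfolding I_def using k(2) by (rule nn_integral_eq_integral) auto
  ultimately show ?thesis using k by (intro that[of k]) auto
qed

lemma H_norm_leI:
  assumes "k \<in> borel_measurable borel" "bessel_pot s k g" "p > 0"
    "(\<integral>\<^sup>+y. ennreal (\<bar>k y\<bar> powr p) \<partial>lborel) \<le> ennreal 1"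
  shows "H_norm_le s p g 1"
proof -
  have fin: "(\<integral>\<^sup>+y. ennreal (\<bar>k y\<bar> powr p) \<partial>lborel) < \<infinity>"
    using assms(4) by (rule le_less_trans) simp
  have int: "integrable lborel (\<lambda>x. \<bar>k x\<bar> powr p)"
    by (rule integrable_of_powr[OF assms(1) fin])
  have "ennreal (\<integral>x. \<bar>k x\<bar> powr p \<partial>lborel) = (\<integral>\<^sup>+y. ennreal (\<bar>k y\<bar> powr p) \<partial>lborel)"
    using int by (intro nn_integral_eq_integral[symmetric]) auto
  also note assms(4)
  finally have "(\<integral>x. \<bar>k x\<bar> powr p \<partial>lborel) \<le> 1" by simp
  hence "(\<integral>x. \<bar>k x\<bar> powr p \<partial>lborel) powr (1 / p) \<le> 1"
    using assms(3) by (intro powr_le1) auto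
  thus ?thesis using assms(1,2) int unfolding H_norm_le_def by (intro exI[of _ k]) simp
qed

section \<open>The counterexample\<close>

context critical_scales
begin

lemma weighted_shell_le:
  "ennreal (weight j) * emeasure lborel (shell j :: 'a set) \<le> 1"
proof -
  have "ennreal (weight j) * emeasure lborel (shell j :: 'a set) \<le> ennreal (weight j) * emeasure lborel (dust j :: 'a set)"
    by (intro mult_left_mono emeasure_mono shell_subset) auto
  also have "\<dots> = ennreal (weight j * (2 ^ j * l j) ^ DIM('a))"
    using weight_pos[of j] l_pos[of j] unfolding emeasure_dust by (intro ennreal_mult[symmetric]) auto
  finally show ?thesis by (simp add: weight_mass)
qed

lemma test_function:
  obtains c where "c > 0"
    "\<And>k. k > 0 \<Longrightarrow> \<exists>g :: 'a \<Rightarrow> real. H_norm_le \<sigma> p g 1 \<and>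
       (AE y in lborel. y \<in> dust k \<longrightarrow> c * (\<Sum>j<k. 1 / x j) powr (1 - 1 / p) \<le> g y)"
proof -
  have \<sigma>0: "\<sigma> > 0" using q by simp
  obtain c where c: "c > 0"
    "\<And>j (x :: 'a). x \<in> dust j \<Longrightarrow> ennreal (c * l j powr \<sigma>) \<le> (\<integral>\<^sup>+y\<in>shell j. ennreal (bessel_kernel \<sigma> (x - y)) \<partial>lborel)"
    using shell_potential_ge[OF \<sigma>0 \<sigma>_less_dim] by blast
  show ?thesis
  proof (rule that[OF c(1)])
    fix k :: nat assume k: "k > 0"
    define N where "N = (\<Sum>j<k. 1 / x j)"
    have xp: "x j > 0" for j using x_ge_1[of j] by simp
    have N: "N > 0" unfolding N_def using k xp by (intro sum_pos) auto
    \<comment> \<open>The equality case of Hoelder: among amplitudes with \<Sum> a_j^p / weight_j =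
      1, the sum of a_j l_j^\<sigma>, which bounds the potential below, is largest when a_j is
      proportional to l_j^(-\<sigma>) / x_j. The power of \<open>N\<close> normalises.\<close>
    define a where "a j = (if j < k then N powr (- 1 / p) * (1 / x j) * l j powr - \<sigma> else 0)" for j
    have a0: "a j \<ge> 0" for j using xp[of j] by (simp add: a_def)
    have ap: "a j powr p = (if j < k then 1 / N * (1 / x j) else 0) * weight j" for j
    proof (cases "j < k")
      case True
      have "(N powr (- 1 / p)) powr p = N powr (- 1)" unfolding powr_powr using p by simp
      hence "(N powr (- 1 / p)) powr p = 1 / N" using N by (simp add: powr_minus_divide)
      moreover have "(1 / x j) powr p = 1 / x j * x j powr (- (p - 1))"
        using xp[of j] powr_add[of "x j" "- (p - 1)" "- 1"] by (simp add: powr_divide powr_minus_divide)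
      moreover have "(l j powr - \<sigma>) powr p = l j powr (- (\<sigma> * p))" by (simp add: powr_powr)
      moreover have "a j powr p = (N powr (- 1 / p)) powr p * (1 / x j) powr p * (l j powr - \<sigma>) powr p"
        using True by (simp only: a_def if_True powr_mult)
      ultimately have "a j powr p = 1 / N * (1 / x j * x j powr (- (p - 1))) * l j powr (- (\<sigma> * p))"
        by (simp only:)
      thus ?thesis using True by (simp add: weight_def)
    qed (simp add: a_def)
    define \<phi> :: "'a \<Rightarrow> real" where "\<phi> = shell_sum a (\<lambda>i. i)"
    define g where "g z = (\<integral>y. bessel_kernel \<sigma> (z - y) * \<phi> y \<partial>lborel)" for z
    have inj: "inj (\<lambda>i::nat. i)" by simp
    have \<phi>0: "\<phi> y \<ge> 0" for y unfolding \<phi>_def by (intro shell_sum_nonneg inj a0)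
    have "(\<integral>\<^sup>+y. ennreal (\<bar>\<phi> y\<bar> powr p) \<partial>lborel) = (\<Sum>m. ennreal (a m powr p) * emeasure lborel (shell m :: 'a set))"
      using nn_integral_shell_sum_powr[where Q = "UNIV :: 'a set" and p = p, OF inj a0] by (simp add: \<phi>_def)
    also have "\<dots> \<le> (\<Sum>m. ennreal (if m < k then 1 / N * (1 / x m) else 0))"
    proof (intro suminf_le summableI)
      fix m
      have "ennreal (a m powr p) * emeasure lborel (shell m :: 'a set) =
        ennreal (if m < k then 1 / N * (1 / x m) else 0) * (ennreal (weight m) * emeasure lborel (shell m :: 'a set))"
        unfolding ap using N xp[of m] weight_pos[of m] by (simp add: ennreal_mult mult.assoc del: times_divide_eq_left times_divide_eq_right)
      also have "\<dots> \<le> ennreal (if m < k then 1 / N * (1 / x m) else 0) * 1"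
        by (intro mult_left_mono weighted_shell_le) auto
      finally show "ennreal (a m powr p) * emeasure lborel (shell m :: 'a set) \<le> ennreal (if m < k then 1 / N * (1 / x m) else 0)"
        by simp
    qed
    also have "\<dots> = (\<Sum>m<k. ennreal (1 / N * (1 / x m)))"
      by (subst suminf_finite[of "{..<k}"]) (auto intro!: sum.cong)
    also have "\<dots> = ennreal (1 / N * (\<Sum>m<k. 1 / x m))"
      using N xp by (subst sum_ennreal) (auto simp: sum_distrib_left less_imp_le)
    also have "\<dots> = ennreal 1" using N by (simp add: N_def)
    finally have \<phi>p: "(\<integral>\<^sup>+y. ennreal (\<bar>\<phi> y\<bar> powr p) \<partial>lborel) \<le> ennreal 1" .
    have \<phi>m: "\<phi> \<in> borel_measurable borel" by (simp add: \<phi>_def)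
    have AE: "AE z in lborel. integrable lborel (\<lambda>y. bessel_kernel \<sigma> (z - y) * \<phi> y) \<and>
       ennreal (\<integral>y. bessel_kernel \<sigma> (z - y) * \<phi> y \<partial>lborel) =
         (\<integral>\<^sup>+y. ennreal (bessel_kernel \<sigma> (z - y)) * ennreal (\<phi> y) \<partial>lborel)"
      by (rule bessel_potential_finite[OF \<sigma>0 \<sigma>p p \<phi>m \<phi>0 le_less_trans[OF \<phi>p]]) simp
    have "bessel_pot \<sigma> \<phi> g"
      unfolding bessel_pot_def g_def using AE \<sigma>0 by (auto elim: eventually_mono)
    hence "H_norm_le \<sigma> p g 1" using \<phi>m \<phi>p p by (intro H_norm_leI) auto
    moreover have "AE z in lborel. z \<in> dust k \<longrightarrow> c * N powr (1 - 1 / p) \<le> g z"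
      using AE
    proof eventually_elim
      case (elim z)
      show ?case
      proof
        assume z: "z \<in> dust k"
        have "ennreal (c * (\<Sum>m\<in>{..<k}. a m * l m powr \<sigma>)) \<le>
          (\<integral>\<^sup>+y. ennreal (bessel_kernel \<sigma> (z - y)) * ennreal (\<phi> y) \<partial>lborel)"
          unfolding \<phi>_def
        proof (intro shell_sum_potential_ge inj a0 \<sigma>0 c(2))
          \<comment> \<open>A point of \<open>dust k\<close> lies in all earlier dusts, so every
            shell below stage \<open>k\<close> contributes at it.\<close>
          show "z \<in> dust m" if "m \<in> {..<k}" for m
            using z dust_mono[of m k] that by auto
        qed (use c(1) in auto)
        also have "\<dots> = ennreal (g z)" using elim by (simp add: g_def)
        finally have "c * (\<Sum>m\<in>{..<k}. a m * l m powr \<sigma>) \<le> g z"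
        proof (subst (asm) ennreal_le_iff)
          show "g z \<ge> 0" unfolding g_def
            by (intro integral_nonneg_AE AE_I2) (simp add: \<phi>0 bessel_kernel_nonneg[OF \<sigma>0])
        qed
        also have "(\<Sum>m\<in>{..<k}. a m * l m powr \<sigma>) = (\<Sum>m<k. N powr (- 1 / p) * (1 / x m))"
        proof (intro sum.cong refl)
          fix m assume "m \<in> {..<k}"
          moreover have "l m powr - \<sigma> * l m powr \<sigma> = 1" using l_pos[of m] by (simp flip: powr_add)
          ultimately show "a m * l m powr \<sigma> = N powr (- 1 / p) * (1 / x m)"
            by (simp add: a_def)
        qed
        also have "\<dots> = N powr (- 1 / p) * N" by (simp only: N_def sum_distrib_left)
        also have "\<dots> = N powr (1 - 1 / p)" using N powr_add[of N "- 1 / p" 1] by simp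
        finally show "c * N powr (1 - 1 / p) \<le> g z" .
      qed
    qed
    ultimately show "\<exists>g :: 'a \<Rightarrow> real. H_norm_le \<sigma> p g 1 \<and>
       (AE y in lborel. y \<in> dust k \<longrightarrow> c * (\<Sum>j<k. 1 / x j) powr (1 - 1 / p) \<le> g y)"
      unfolding N_def by blast
  qed
qed

lemma measure_shell_pos: "measure lborel (shell k :: 'a set) > 0"
  and emeasure_shell_finite: "emeasure lborel (shell k :: 'a set) < \<infinity>"
proof -
  have "emeasure lborel (shell k :: 'a set) \<le> emeasure lborel (dust k :: 'a set)"
    by (intro emeasure_mono shell_subset) auto
  also have "\<dots> < \<infinity>" by (simp add: emeasure_dust)
  finally show fin: "emeasure lborel (shell k :: 'a set) < \<infinity>" .
  have "0 < ennreal ((1 - 2 * \<theta>) * (2 ^ k * l k) ^ DIM('a))"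
    using \<theta> l_pos[of k] by simp
  also have "\<dots> \<le> emeasure lborel (shell k :: 'a set)" by (rule emeasure_shell_ge)
  also have "\<dots> = ennreal (measure lborel (shell k :: 'a set))"
    using fin by (intro emeasure_eq_ennreal_measure) auto
  finally show "measure lborel (shell k :: 'a set) > 0" by simp
qed

lemma emeasure_shell: "emeasure lborel (shell k :: 'a set) = ennreal (measure lborel (shell k :: 'a set))"
  using emeasure_shell_finite[of k, THEN less_imp_neq] by (intro emeasure_eq_ennreal_measure) simp

lemma weighted_shell_ge: "1 - 2 * \<theta> \<le> weight k * measure lborel (shell k :: 'a set)"
proof -
  have "ennreal ((1 - 2 * \<theta>) * (2 ^ k * l k) ^ DIM('a)) \<le> ennreal (measure lborel (shell k :: 'a set))"
    using emeasure_shell_ge[where 'a = 'a and k = k] by (simp only: emeasure_shell)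
  hence "(1 - 2 * \<theta>) * (2 ^ k * l k) ^ DIM('a) \<le> measure lborel (shell k :: 'a set)" by simp
  hence "weight k * ((1 - 2 * \<theta>) * (2 ^ k * l k) ^ DIM('a)) \<le> weight k * measure lborel (shell k :: 'a set)"
    using weight_pos[of k] by (intro mult_left_mono) auto
  moreover have "weight k * ((1 - 2 * \<theta>) * (2 ^ k * l k) ^ DIM('a)) = (1 - 2 * \<theta>) * (weight k * (2 ^ k * l k) ^ DIM('a))"
    by simp
  ultimately show ?thesis by (simp only: weight_mass mult_1_right)
qed

text \<open>For t = 0 the potential is the function itself, and Young with threshold |F|^(-1/p) is
  enough, \<open>F\<close> being the shell. For t > 0 the Riesz kernel dominates and
  \<open>dust_ball_bound\<close> gives the geometry. The constant is fixed before the stage.\<close>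

lemma shell_trace:
  fixes t :: real
  assumes t: "0 \<le> t" "t < q"
  obtains C where "C > 0"
    "\<And>k \<kappa> (u :: 'a \<Rightarrow> real) D. \<kappa> \<in> borel_measurable borel \<Longrightarrow> D \<ge> 0 \<Longrightarrow>
       (\<integral>\<^sup>+y. ennreal (\<bar>\<kappa> y\<bar> powr p) \<partial>lborel) \<le> ennreal D \<Longrightarrow> bessel_pot t \<kappa> u \<Longrightarrow>
       (\<integral>\<^sup>+y\<in>shell k. ennreal \<bar>u y\<bar> \<partial>lborel) \<le>
         ennreal (C * (1 + D) * (l k powr t * measure lborel (shell k :: 'a set) powr (1 - 1 / p)))"
proof (cases "t = 0")
  case True
  show ?thesis
  proof (rule that[of 1])
    fix k D and \<kappa> u :: "'a \<Rightarrow> real"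
    assume \<kappa>[measurable]: "\<kappa> \<in> borel_measurable borel" and D: "D \<ge> 0" "(\<integral>\<^sup>+y. ennreal (\<bar>\<kappa> y\<bar> powr p) \<partial>lborel) \<le> ennreal D"
      and u: "bessel_pot t \<kappa> u"
    define V where "V = measure lborel (shell k :: 'a set)"
    have V: "V > 0" "emeasure lborel (shell k :: 'a set) = ennreal V"
      using measure_shell_pos by (auto simp: V_def emeasure_shell)
    define m where "m = V powr (- 1 / p)"
    have m: "m > 0" using V by (simp add: m_def)
    have "AE y in lborel. u y = \<kappa> y" using u True by (simp add: bessel_pot_def)
    hence "(\<integral>\<^sup>+y\<in>shell k. ennreal \<bar>u y\<bar> \<partial>lborel) \<le>
       (\<integral>\<^sup>+y. (ennreal (m powr (1 - p)) * ennreal (\<bar>\<kappa> y\<bar> powr p) + ennreal m * indicator (shell k) y) \<partial>lborel)"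
    proof (intro nn_integral_mono_AE, eventually_elim)
      case (elim y)
      have "ennreal \<bar>u y\<bar> \<le> ennreal (m powr (1 - p) * \<bar>\<kappa> y\<bar> powr p + m)"
        unfolding elim by (intro ennreal_leI abs_le_young m p)
      also have "\<dots> = ennreal (m powr (1 - p)) * ennreal (\<bar>\<kappa> y\<bar> powr p) + ennreal m"
        using m by (simp add: ennreal_mult)
      finally show ?case by (auto simp: indicator_def)
    qed
    also have "\<dots> = ennreal (m powr (1 - p)) * (\<integral>\<^sup>+y. ennreal (\<bar>\<kappa> y\<bar> powr p) \<partial>lborel) + ennreal m * ennreal V"
      by (subst nn_integral_add) (auto simp: nn_integral_cmult nn_integral_cmult_indicator V)
    also have "\<dots> \<le> ennreal (m powr (1 - p)) * ennreal D + ennreal m * ennreal V"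
      by (intro add_right_mono mult_left_mono D) auto
    also have "\<dots> = ennreal (m powr (1 - p) * D + m * V)"
      using m D V by (simp add: ennreal_mult)
    also have "m powr (1 - p) = V powr (1 - 1 / p)"
    proof -
      have e: "- 1 / p * (1 - p) = 1 - 1 / p" using p by (simp add: field_simps)
      show ?thesis unfolding m_def powr_powr e ..
    qed
    also have "m * V = V powr (1 - 1 / p)" using V powr_add[of V "- 1 / p" 1] by (simp add: m_def)
    finally show "(\<integral>\<^sup>+y\<in>shell k. ennreal \<bar>u y\<bar> \<partial>lborel) \<le>
         ennreal (1 * (1 + D) * (l k powr t * measure lborel (shell k :: 'a set) powr (1 - 1 / p)))"
      using True l_pos[of k] by (simp add: V_def algebra_simps)
  qed simp
next
  case False
  with t have t0: "0 < t" by simp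
  have tn: "t < real DIM('a)" using t q \<sigma>_less_dim by simp
  define M where "M = unit_ball_vol (real DIM('a)) + 2 ^ DIM('a) * (2 * \<Theta>) powr (real DIM('a) - q * p)"
  have M: "M \<ge> 0" by (simp add: M_def)
  define C where "C = riesz_trace_const (real DIM('a)) t q M"
  obtain C' where C': "C' > 0" "\<And>z :: 'a. z \<noteq> 0 \<Longrightarrow> bessel_kernel t z \<le> C' * norm z powr (t - real DIM('a))"
    using bessel_kernel_upper[OF t0 tn] by blast
  show ?thesis
  \<comment> \<open>The maximum makes positivity immediate.\<close>
  proof (rule that[of "C' * max C 1"])
    show "C' * max C 1 > 0" using C' by simp
    fix k D and \<kappa> u :: "'a \<Rightarrow> real"
    assume \<kappa>[measurable]: "\<kappa> \<in> borel_measurable borel" and D: "D \<ge> 0" "(\<integral>\<^sup>+y. ennreal (\<bar>\<kappa> y\<bar> powr p) \<partial>lborel) \<le> ennreal D"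
      and u: "bessel_pot t \<kappa> u"
    define W where "W = l k powr t * measure lborel (shell k :: 'a set) powr (1 - 1 / p)"
    have ball: "emeasure lborel (shell k \<inter> cball y \<rho>) \<le> ennreal (M * \<rho> ^ DIM('a) * (min 1 ((l k / \<rho>) powr q)) powr p)"
      if "\<rho> > 0" for y :: 'a and \<rho>
    proof -
      have "emeasure lborel (shell k \<inter> cball y \<rho>) \<le> emeasure lborel (dust k \<inter> cball y \<rho>)"
        using shell_subset by (intro emeasure_mono) auto
      also note dust_ball_bound[OF that]
      finally show ?thesis by (simp add: M_def)
    qed
    have "AE z in lborel. integrable lborel (\<lambda>y. bessel_kernel t (z - y) * \<kappa> y) \<and>
       u z = (\<integral>y. bessel_kernel t (z - y) * \<kappa> y \<partial>lborel)"
      using u False by (simp add: bessel_pot_def)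
    hence "(\<integral>\<^sup>+z\<in>shell k. ennreal \<bar>u z\<bar> \<partial>lborel) \<le>
      (\<integral>\<^sup>+z\<in>shell k. ennreal C' * (\<integral>\<^sup>+y. ennreal (norm (z - y) powr (t - real DIM('a))) * ennreal \<bar>\<kappa> y\<bar> \<partial>lborel) \<partial>lborel)"
    proof (intro nn_integral_mono_AE, eventually_elim)
      case (elim z)
      have "ennreal \<bar>u z\<bar> \<le> (\<integral>\<^sup>+y. ennreal (norm (bessel_kernel t (z - y) * \<kappa> y)) \<partial>lborel)"
        using integral_norm_bound_ennreal[of lborel "\<lambda>y. bessel_kernel t (z - y) * \<kappa> y"] elim by simp
      also have "\<dots> \<le> (\<integral>\<^sup>+y. ennreal C' * (ennreal (norm (z - y) powr (t - real DIM('a))) * ennreal \<bar>\<kappa> y\<bar>) \<partial>lborel)"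
      proof (rule nn_integral_mono_AE)
        show "AE y in lborel. ennreal (norm (bessel_kernel t (z - y) * \<kappa> y)) \<le>
           ennreal C' * (ennreal (norm (z - y) powr (t - real DIM('a))) * ennreal \<bar>\<kappa> y\<bar>)"
          using AE_lborel_singleton[of z]
        proof eventually_elim
          case (elim y)
          have "norm (bessel_kernel t (z - y) * \<kappa> y) \<le> C' * norm (z - y) powr (t - real DIM('a)) * \<bar>\<kappa> y\<bar>"
            using C'(2)[of "z - y"] elim bessel_kernel_nonneg[OF t0, of "z - y"]
            by (simp add: abs_mult mult_right_mono)
          thus ?case using C'(1) by (simp add: ennreal_mult[symmetric] mult.assoc ennreal_leI)
        qed
      qed
      also have "\<dots> = ennreal C' * (\<integral>\<^sup>+y. ennreal (norm (z - y) powr (t - real DIM('a))) * ennreal \<bar>\<kappa> y\<bar> \<partial>lborel)"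
        by (rule nn_integral_cmult) measurable
      finally show ?case by (rule mult_right_mono) simp
    qed
    also have "\<dots> = ennreal C' * (\<integral>\<^sup>+z\<in>shell k. (\<integral>\<^sup>+y. ennreal (norm (z - y) powr (t - real DIM('a))) * ennreal \<bar>\<kappa> y\<bar> \<partial>lborel) \<partial>lborel)"
      by (simp add: mult.assoc nn_integral_cmult)
    also have "\<dots> \<le> ennreal C' * ennreal (C * (1 + D) * W)"
      unfolding C_def W_def
      by (intro mult_left_mono riesz_trace[OF t0 t(2) tn p M _ emeasure_shell_finite measure_shell_pos l_pos ball \<kappa> D]) auto
    also have "\<dots> \<le> ennreal C' * ennreal (max C 1 * (1 + D) * W)"
      using D by (intro mult_left_mono ennreal_leI mult_right_mono) (auto simp: W_def)
    also have "\<dots> = ennreal (C' * max C 1 * (1 + D) * W)"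
      using C'(1) D by (subst ennreal_mult[symmetric]) (auto simp: W_def mult.assoc)
    finally show "(\<integral>\<^sup>+y\<in>shell k. ennreal \<bar>u y\<bar> \<partial>lborel) \<le>
         ennreal (C' * max C 1 * (1 + D) * (l k powr t * measure lborel (shell k :: 'a set) powr (1 - 1 / p)))"
      by (simp add: W_def)
  qed
qed

section \<open>Sparse stages and the contradiction\<close>

lemma sparse_sequence:
  obtains k :: "nat \<Rightarrow> nat" where "inj k" "\<And>m. k m > 0" "\<And>m. 4 ^ m \<le> (\<Sum>j<k m. 1 / x j) powr (p - 1)"
proof -
  define N where "N k = (\<Sum>j<k. 1 / x j)" for k
  have xp: "1 / x j \<ge> 0" for j using x_ge_1[of j] by simp
  have large: "\<exists>k>K. Z \<le> N k powr (p - 1)" if Z: "Z > 0" for K :: nat and Z :: real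
  proof -
    have "\<exists>k. N k > Z powr (1 / (p - 1))"
    proof (rule ccontr)
      assume "\<not> ?thesis"
      hence "summable (\<lambda>j. 1 / x j)"
        using xp by (intro summableI_nonneg_bounded[of _ "Z powr (1 / (p - 1))"]) (auto simp: N_def not_less)
      with diverges show False ..
    qed
    then obtain k where k: "N k > Z powr (1 / (p - 1))" ..
    have "N k \<le> N (max k (Suc K))" unfolding N_def using xp by (intro sum_mono2) auto
    with k have "(Z powr (1 / (p - 1))) powr (p - 1) \<le> N (max k (Suc K)) powr (p - 1)"
      using p by (intro powr_mono2) auto
    also have "(Z powr (1 / (p - 1))) powr (p - 1) = Z" using Z p by (simp add: powr_powr)
    finally show ?thesis by (intro exI[of _ "max k (Suc K)"]) auto
  qed
  have "\<exists>k. \<forall>m. (0 < k m \<and> 4 ^ m \<le> N (k m) powr (p - 1)) \<and> k m < k (Suc m)"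
  proof (rule dependent_nat_choice)
    show "\<exists>k>0. 4 ^ 0 \<le> N k powr (p - 1)" by (rule large) simp
    fix k :: nat and m :: nat
    from large[of "4 ^ Suc m" k] obtain k' where "k' > k" "4 ^ Suc m \<le> N k' powr (p - 1)" by auto
    thus "\<exists>k'. (0 < k' \<and> 4 ^ Suc m \<le> N k' powr (p - 1)) \<and> k < k'" by (intro exI[of _ k']) auto
  qed
  then obtain k where k: "\<And>m. 0 < k m" "\<And>m. 4 ^ m \<le> N (k m) powr (p - 1)" "\<And>m. k m < k (Suc m)" by blast
  have "inj k" using k(3) by (intro strict_mono_imp_inj_on) (simp add: strict_mono_Suc_iff)
  thus ?thesis using that k unfolding N_def by blast
qed

lemma counterexample:
  fixes t r \<tau> :: real
  assumes t: "0 \<le> t" "t < q" and \<sigma>: "\<sigma> = t + r" and \<tau>: "p * \<tau> \<le> p - 1"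
  shows "\<exists>f :: 'a \<Rightarrow> real. f \<in> M_space t \<tau> r p \<and> f \<notin> X_space t r p"
proof -
  obtain k :: "nat \<Rightarrow> nat" where k: "inj k" "\<And>m. k m > 0" "\<And>m. 4 ^ m \<le> (\<Sum>j<k m. 1 / x j) powr (p - 1)"
    using sparse_sequence by blast
  \<comment> \<open>On its shell h^p equals 2^-m times the normalising weight: summable over stages,
    yet small enough a loss to be beaten by the gain 4^m.\<close>
  define w where "w m = ((1 / 2) ^ m * weight (k m)) powr (1 / p)" for m
  have w0: "w m > 0" for m using weight_pos[of "k m"] by (simp add: w_def)
  have wp: "w m powr p = (1 / 2) ^ m * weight (k m)" for m
    using weight_pos[of "k m"] p by (simp add: w_def powr_powr)
  define h :: "'a \<Rightarrow> real" where "h = shell_sum w k"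
  have hm: "h \<in> borel_measurable borel" by (simp add: h_def)
  have h0: "h y \<ge> 0" for y unfolding h_def using w0 by (intro shell_sum_nonneg k) (simp add: less_imp_le)
  \<comment> \<open>A bound common to all weighted dusts passes to h^p at the cost of the geometric
    sum 2. It is used on the whole space for integrability and on small cubes for the growth
    condition.\<close>
  have bound: "(\<integral>\<^sup>+y\<in>Q. ennreal (\<bar>h y\<bar> powr p) \<partial>lborel) \<le> ennreal (2 * B)"
    if Q: "Q \<in> sets borel" and B: "B \<ge> 0" "\<And>j. ennreal (weight j) * emeasure lborel (dust j \<inter> Q) \<le> ennreal B"
    for B and Q :: "'a set"
  proof -
    have "(\<integral>\<^sup>+y\<in>Q. ennreal (\<bar>h y\<bar> powr p) \<partial>lborel) = (\<Sum>m. ennreal (w m powr p) * emeasure lborel (shell (k m) \<inter> Q))"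
      unfolding h_def using w0 Q by (intro nn_integral_shell_sum_powr k) (simp_all add: less_imp_le)
    also have "\<dots> \<le> (\<Sum>m. ennreal ((1 / 2) ^ m * B))"
    proof (intro suminf_le summableI)
      fix m
      have "ennreal (w m powr p) * emeasure lborel (shell (k m) \<inter> Q) \<le>
        ennreal (w m powr p) * emeasure lborel (dust (k m) \<inter> Q)"
        using shell_subset Q by (intro mult_left_mono emeasure_mono) auto
      also have "\<dots> = ennreal ((1 / 2) ^ m) * (ennreal (weight (k m)) * emeasure lborel (dust (k m) \<inter> Q))"
        using weight_pos[of "k m"] unfolding wp by (subst ennreal_mult) (auto simp: mult.assoc)
      also have "\<dots> \<le> ennreal ((1 / 2) ^ m) * ennreal B"
        by (intro mult_left_mono B) auto
      also have "\<dots> = ennreal ((1 / 2) ^ m * B)" using B(1) by (intro ennreal_mult[symmetric]) auto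
      finally show "ennreal (w m powr p) * emeasure lborel (shell (k m) \<inter> Q) \<le> ennreal ((1 / 2) ^ m * B)" .
    qed
    also have "\<dots> = ennreal (\<Sum>m. (1 / 2) ^ m * B)"
      using B(1) by (intro suminf_ennreal2 summable_mult2 summable_geometric) auto
    also have "(\<Sum>m. (1 / 2) ^ m * B) = 2 * B"
      by (subst suminf_mult2[symmetric]) (auto simp: suminf_geometric)
    finally show ?thesis .
  qed
  have "(\<integral>\<^sup>+y\<in>UNIV. ennreal (\<bar>h y\<bar> powr p) \<partial>lborel) \<le> ennreal (2 * 1)"
  proof (rule bound)
    fix j
    have "ennreal (weight j) * emeasure lborel (dust j :: 'a set) = ennreal (weight j * (2 ^ j * l j) ^ DIM('a))"
      using weight_pos[of j] l_pos[of j] unfolding emeasure_dust by (intro ennreal_mult[symmetric]) auto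
    thus "ennreal (weight j) * emeasure lborel (dust j \<inter> UNIV :: 'a set) \<le> ennreal 1"
      by (simp add: weight_mass)
  qed auto
  hence fin: "(\<integral>\<^sup>+y. ennreal (\<bar>h y\<bar> powr p) \<partial>lborel) < \<infinity>"
    by (simp add: le_less_trans)
  define f where "f = (if t = 0 then h else (\<lambda>z. \<integral>y. bessel_kernel t (z - y) * h y \<partial>lborel))"
  have AE: "AE z in lborel. integrable lborel (\<lambda>y. bessel_kernel t (z - y) * h y) \<and>
       ennreal (\<integral>y. bessel_kernel t (z - y) * h y \<partial>lborel) =
         (\<integral>\<^sup>+y. ennreal (bessel_kernel t (z - y)) * ennreal (h y) \<partial>lborel)" if "t \<noteq> 0"
  proof (rule bessel_potential_finite[OF _ _ p hm h0 fin])
    show "0 < t" using that t by simp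
    have "t * p < \<sigma> * p" using t q p by (intro mult_strict_right_mono) auto
    thus "t * p < real DIM('a)" using \<sigma>p by linarith
  qed
  have pot: "bessel_pot t h f"
    unfolding bessel_pot_def f_def using AE by (auto elim: eventually_mono)
  define B where "B = 2 ^ DIM('a) * \<Theta> powr (real DIM('a) - \<sigma> * p) * L powr (p - 1)"
  have B: "B > 0" using \<Theta>(1) L(1) by (simp add: B_def)
  have "f \<in> M_space t \<tau> r p"
  proof (rule M_spaceI[OF p \<tau> _ hm pot fin])
    show "2 * B > 0" using B by simp
    fix u :: 'a and \<rho> :: real assume \<rho>: "0 < \<rho>" "\<rho> \<le> 1"
    have "(\<integral>\<^sup>+x\<in>cbox u (u + \<rho> *\<^sub>R One). ennreal (\<bar>h x\<bar> powr p) \<partial>lborel)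
       \<le> ennreal (2 * (B * (\<rho> powr (real DIM('a) - \<sigma> * p) * (1 - log 2 (\<rho> ^ DIM('a))) powr (- (p - 1)))))"
      using B weighted_cube_bound[OF \<rho>] by (intro bound) (auto simp: B_def)
    thus "(\<integral>\<^sup>+x\<in>cbox u (u + \<rho> *\<^sub>R One). ennreal (\<bar>h x\<bar> powr p) \<partial>lborel)
       \<le> ennreal (2 * B * (\<rho> powr (real DIM('a) - (t + r) * p) * (1 - log 2 (\<rho> ^ DIM('a))) powr (- (p - 1))))"
      by (simp only: \<sigma> mult.assoc)
  qed
  moreover have "f \<notin> X_space t r p"
  proof
    assume "f \<in> X_space t r p"
    then obtain C where C: "\<And>g. H_norm_le (t + r) p g 1 \<Longrightarrow> H_norm_le t p (\<lambda>x. f x * g x) C"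
      unfolding X_space_def by blast
    obtain c1 where c1: "c1 > 0" "\<And>k. k > 0 \<Longrightarrow> \<exists>g :: 'a \<Rightarrow> real. H_norm_le \<sigma> p g 1 \<and>
       (AE y in lborel. y \<in> dust k \<longrightarrow> c1 * (\<Sum>j<k. 1 / x j) powr (1 - 1 / p) \<le> g y)"
      using test_function by blast
    obtain C3 where C3: "C3 > 0"
      "\<And>k \<kappa> (u :: 'a \<Rightarrow> real) D. \<kappa> \<in> borel_measurable borel \<Longrightarrow> D \<ge> 0 \<Longrightarrow>
       (\<integral>\<^sup>+y. ennreal (\<bar>\<kappa> y\<bar> powr p) \<partial>lborel) \<le> ennreal D \<Longrightarrow> bessel_pot t \<kappa> u \<Longrightarrow>
       (\<integral>\<^sup>+y\<in>shell k. ennreal \<bar>u y\<bar> \<partial>lborel) \<le>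
         ennreal (C3 * (1 + D) * (l k powr t * measure lborel (shell k :: 'a set) powr (1 - 1 / p)))"
      using shell_trace[OF t] by blast
    \<comment> \<open>On each chosen shell only that shell's own share of \<open>h\<close> is kept.
      The case t = 0 is separate because \<open>f\<close> is then \<open>h\<close> and not a
      convolution.\<close>
    have "\<exists>c>0. \<forall>m. AE z in lborel. z \<in> shell (k m) \<longrightarrow> c * w m * l (k m) powr t \<le> f z"
    proof (cases "t = 0")
      case True
      have "1 * w m * l (k m) powr t \<le> f z" if "z \<in> shell (k m)" for m z
        using True that k(1) l_pos[of "k m"] by (simp add: f_def h_def shell_sum_eq)
      thus ?thesis by (intro exI[of _ 1]) auto
    next
      case False
      have t': "0 < t" "t < real DIM('a)" using False t q \<sigma>_less_dim by auto
      obtain c where c: "c > 0"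
        "\<And>j (x :: 'a). x \<in> dust j \<Longrightarrow> ennreal (c * l j powr t) \<le> (\<integral>\<^sup>+y\<in>shell j. ennreal (bessel_kernel t (x - y)) \<partial>lborel)"
        using shell_potential_ge[OF t'] by blast
      have "AE z in lborel. z \<in> shell (k m) \<longrightarrow> c * w m * l (k m) powr t \<le> f z" for m
        using AE[OF False]
      proof eventually_elim
        case (elim z)
        show ?case
        proof
          assume "z \<in> shell (k m)"
          hence z: "z \<in> dust (k m)" using shell_subset by blast
          have "ennreal (c * (\<Sum>i\<in>{m}. w i * l (k i) powr t)) \<le>
            (\<integral>\<^sup>+y. ennreal (bessel_kernel t (z - y)) * ennreal (h y) \<partial>lborel)"
            unfolding h_def using z c w0 t'
            by (intro shell_sum_potential_ge k) (auto intro: less_imp_le)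
          also have "\<dots> = ennreal (f z)" using elim False by (simp add: f_def)
          finally show "c * w m * l (k m) powr t \<le> f z"
          proof (subst (asm) ennreal_le_iff)
            show "f z \<ge> 0" unfolding f_def using False
              by (auto intro!: integral_nonneg_AE simp: h0 bessel_kernel_nonneg[OF t'(1)])
          qed (simp add: mult.assoc)
        qed
      qed
      with c(1) show ?thesis by blast
    qed
    then obtain c2 where c2: "c2 > 0" "\<And>m. AE z in lborel. z \<in> shell (k m) \<longrightarrow> c2 * w m * l (k m) powr t \<le> f z"
      by blast
    define E where "E = C3 * (1 + \<bar>C\<bar> powr p)"
    have E: "E > 0" using C3(1) by (simp add: E_def add_pos_nonneg)
    have main: "(c1 * c2) powr p * (1 - 2 * \<theta>) * 2 ^ m \<le> E powr p" for m
    proof -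
      define N where "N = (\<Sum>j<k m. 1 / x j)"
      define V where "V = measure lborel (shell (k m) :: 'a set)"
      have V: "V > 0" by (simp add: V_def measure_shell_pos)
      obtain g :: "'a \<Rightarrow> real" where g: "H_norm_le \<sigma> p g 1"
        "AE y in lborel. y \<in> dust (k m) \<longrightarrow> c1 * N powr (1 - 1 / p) \<le> g y"
        using c1(2)[OF k(2)[of m]] unfolding N_def by blast
      have "H_norm_le t p (\<lambda>x. f x * g x) C" using C g(1) by (simp add: \<sigma>)
      then obtain \<kappa> where \<kappa>: "\<kappa> \<in> borel_measurable borel" "bessel_pot t \<kappa> (\<lambda>x. f x * g x)"
        "(\<integral>\<^sup>+y. ennreal (\<bar>\<kappa> y\<bar> powr p) \<partial>lborel) \<le> ennreal (\<bar>C\<bar> powr p)"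
        using p by (elim H_norm_leE) auto
      define a where "a = c2 * w m * l (k m) powr t"
      define b where "b = c1 * N powr (1 - 1 / p)"
      have ab: "a \<ge> 0" "b \<ge> 0" using c1(1) c2(1) w0[of m] by (auto simp: a_def b_def)
      have "ennreal (a * b * V) = (\<integral>\<^sup>+y. ennreal (a * b) * indicator (shell (k m) :: 'a set) y \<partial>lborel)"
        using ab V by (simp add: nn_integral_cmult_indicator emeasure_shell V_def[symmetric] ennreal_mult)
      also have "\<dots> \<le> (\<integral>\<^sup>+y\<in>shell (k m). ennreal \<bar>f y * g y\<bar> \<partial>lborel)"
      proof (rule nn_integral_mono_AE)
        show "AE y in lborel. ennreal (a * b) * indicator (shell (k m) :: 'a set) y \<le> ennreal \<bar>f y * g y\<bar> * indicator (shell (k m)) y"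
          using g(2) c2(2)[of m]
        proof eventually_elim
          case (elim y)
          show ?case
          proof (cases "y \<in> shell (k m)")
            case True
            hence "a \<le> f y" "b \<le> g y" using elim shell_subset[of "k m"] by (auto simp: a_def b_def)
            hence "a * b \<le> \<bar>f y * g y\<bar>" using ab by (auto simp: abs_mult intro!: mult_mono)
            thus ?thesis using True by (simp add: ennreal_leI)
          qed simp
        qed
      qed
      also have "\<dots> \<le> ennreal (C3 * (1 + \<bar>C\<bar> powr p) * (l (k m) powr t * V powr (1 - 1 / p)))"
        unfolding V_def by (intro C3(2)[OF \<kappa>(1) _ \<kappa>(3,2)]) simp
      finally have "a * b * V \<le> E * (l (k m) powr t * V powr (1 - 1 / p))"
        using E by (subst (asm) ennreal_le_iff) (auto simp: E_def)
      also have "V powr (1 - 1 / p) = V * V powr (- 1 / p)" using V powr_add[of V 1 "- 1 / p"] by simp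
      \<comment> \<open>The factor l^t occurs in the lower bound for \<open>f\<close> and in the
        trace inequality, so it cancels along with \<open>V\<close>; what remains does not involve
        \<open>t\<close>.\<close>
      finally have "(l (k m) powr t * V) * (c1 * c2 * w m * N powr (1 - 1 / p)) \<le> (l (k m) powr t * V) * (E * V powr (- 1 / p))"
        by (simp add: a_def b_def mult_ac)
      hence "c1 * c2 * w m * N powr (1 - 1 / p) \<le> E * V powr (- 1 / p)"
        using V l_pos[of "k m"] by (subst (asm) mult_le_cancel_left_pos) auto
      hence "(c1 * c2 * w m * N powr (1 - 1 / p)) powr p \<le> (E * V powr (- 1 / p)) powr p"
        using c1(1) c2(1) w0[of m] p by (intro powr_mono2) auto
      also have "\<dots> = E powr p * V powr (- 1)"
      proof -
        have "- 1 / p * p = - 1" using p by simp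
        thus ?thesis unfolding powr_mult powr_powr by simp
      qed
      also have "(c1 * c2 * w m * N powr (1 - 1 / p)) powr p = (c1 * c2) powr p * ((1 / 2) ^ m * weight (k m)) * N powr (p - 1)"
      proof -
        have "(1 - 1 / p) * p = p - 1" using p by (simp add: field_simps)
        thus ?thesis unfolding powr_mult[of _ "w m"] powr_mult[of _ "N powr _"] powr_powr wp by simp
      qed
      finally have "(c1 * c2) powr p * ((1 / 2) ^ m * weight (k m)) * N powr (p - 1) * V \<le> E powr p * V powr (- 1) * V"
        using V by (intro mult_right_mono) auto
      also have "\<dots> = E powr p" using V by (simp add: powr_minus)
      finally have *: "(c1 * c2) powr p * (weight (k m) * V) * ((1 / 2) ^ m * N powr (p - 1)) \<le> E powr p"
        by (simp add: mult_ac)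
      \<comment> \<open>The gain 4^m against the weight 2^-m leaves 2^m, unbounded, while
        \<open>E\<close> is fixed.\<close>
      have "(1 / 2) ^ m * 4 ^ m = (2::real) ^ m" by (simp flip: power_mult_distrib)
      hence "(2::real) ^ m \<le> (1 / 2) ^ m * N powr (p - 1)"
        using mult_left_mono[OF k(3)[of m], of "(1 / 2) ^ m"] by (simp add: N_def)
      moreover have "1 - 2 * \<theta> \<le> weight (k m) * V" unfolding V_def by (rule weighted_shell_ge)
      ultimately have "(c1 * c2) powr p * (1 - 2 * \<theta>) * 2 ^ m \<le> (c1 * c2) powr p * (weight (k m) * V) * ((1 / 2) ^ m * N powr (p - 1))"
        using \<theta> V weight_pos[of "k m"] by (intro mult_mono mult_left_mono) auto
      with * show ?thesis by linarith
    qed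
    define \<eta> where "\<eta> = (c1 * c2) powr p * (1 - 2 * \<theta>)"
    have \<eta>: "\<eta> > 0" using c1(1) c2(1) \<theta> by (simp add: \<eta>_def)
    obtain m where "E powr p / \<eta> < 2 ^ m" using real_arch_pow[of 2 "E powr p / \<eta>"] by auto
    hence "E powr p < \<eta> * 2 ^ m" using \<eta> by (simp add: field_simps)
    with main[of m] show False by (simp add: \<eta>_def)
  qed
  ultimately show ?thesis by blast
qed

end

section \<open>Existence of critical scales\<close>

lemma eventually_powr_le:
  fixes A B :: real
  assumes "A > 0"
  shows "\<forall>\<^sub>F N in sequentially. (1 + 1 / real N) powr B \<le> 2 powr A"
proof -
  have "(\<lambda>N. (1 + 1 / real N) powr B) \<longlonglongrightarrow> (1 + 0) powr B"
    by (intro tendsto_intros lim_1_over_n) auto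
  moreover have "(1 + 0) powr B < 2 powr A" using assms by simp
  ultimately show ?thesis
    by (rule eventually_mono[OF order_tendstoD(2)]) simp
qed

text \<open>With l_j = 2^(-\<alpha> j) x_j^\<beta>, the equation \<open>mass\<close> separates into
  \<alpha> (n - \<sigma>p) = n and \<beta> (n - \<sigma>p) = p - 1. The remaining conditions compare
  consecutive stages, where the geometric factor must beat a power of x_(j+1) / x_j.\<close>

lemma critical_scales_exist:
  fixes \<sigma> q p :: real
  assumes p: "p > 1" and q: "0 < q" "q < \<sigma>" and \<sigma>p: "\<sigma> * p < real DIM('a::euclidean_space)"
  obtains l \<theta> x \<Theta> L where "critical_scales TYPE('a) l \<theta> \<sigma> q p x \<Theta> L"
proof -
  define n where "n = real DIM('a)"
  define \<alpha> where "\<alpha> = n / (n - \<sigma> * p)"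
  define \<beta> where "\<beta> = (p - 1) / (n - \<sigma> * p)"
  define e where "e = (\<sigma> - q) * p"
  have n: "n > 0" "n - \<sigma> * p > 0" using \<sigma>p by (auto simp: n_def)
  have \<sigma>p0: "\<sigma> * p > 0" and e0: "e > 0" using p q by (auto simp: e_def)
  have \<alpha>: "\<alpha> > 1" using n \<sigma>p0 by (simp add: \<alpha>_def field_simps)
  have \<beta>: "\<beta> > 0" using n p by (simp add: \<beta>_def)
  have "\<forall>\<^sub>F N in sequentially. (1 + 1 / real N) powr \<beta> \<le> 2 powr ((\<alpha> - 1) / 2) \<and>
      (1 + 1 / real N) powr (\<beta> * (\<sigma> * p) + (p - 1)) \<le> 2 powr (\<alpha> * (\<sigma> * p)) \<and>
      (1 + 1 / real N) powr (\<beta> * e + (p - 1)) \<le> 2 powr (\<alpha> * e) \<and> N \<ge> 1"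
    using \<alpha> \<sigma>p0 e0 by (intro eventually_conj eventually_powr_le eventually_ge_at_top) auto
  then obtain N :: nat where N: "N \<ge> 1" "(1 + 1 / real N) powr \<beta> \<le> 2 powr ((\<alpha> - 1) / 2)"
      "(1 + 1 / real N) powr (\<beta> * (\<sigma> * p) + (p - 1)) \<le> 2 powr (\<alpha> * (\<sigma> * p))"
      "(1 + 1 / real N) powr (\<beta> * e + (p - 1)) \<le> 2 powr (\<alpha> * e)"
    by (auto simp: eventually_sequentially)
  \<comment> \<open>Shifting by \<open>N\<close> brings all ratios x_(j+1) / x_j close enough to 1
    for the comparisons to hold from stage 0 on, and keeps the harmonic sum divergent.\<close>
  define x where "x j = real (j + N)" for j
  define l where "l j = 2 powr (- (\<alpha> * real j)) * x j powr \<beta>" for j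
  define u where "u j = 1 + 1 / x j" for j
  have x1: "x j \<ge> 1" for j using N(1) by (simp add: x_def)
  have x0: "x j > 0" for j using x1[of j] by simp
  have x_Suc: "x (Suc j) = x j * u j" for j using x0[of j] by (simp add: u_def x_def field_simps)
  have u1: "u j \<ge> 1" for j using x0[of j] by (simp add: u_def)
  have u_le: "u j powr b \<le> (1 + 1 / real N) powr b" if "b \<ge> 0" for b j
    using that u1[of j] N(1) by (intro powr_mono2) (auto simp: u_def x_def intro!: divide_left_mono)
  have l_pos: "l j > 0" for j using x0[of j] by (simp add: l_def)
  have l_Suc: "l (Suc j) = l j * (2 powr (- \<alpha>) * u j powr \<beta>)" for j
    using x0[of j] u1[of j] by (simp add: l_def x_Suc powr_mult powr_add[symmetric] algebra_simps)
  have l_powr_Suc: "l (Suc j) powr b = l j powr b * (2 powr (- (\<alpha> * b)) * u j powr (\<beta> * b))" for b j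
    unfolding l_Suc by (simp add: powr_mult powr_powr)
  \<comment> \<open>The ratio of consecutive scales is 2^(-\<alpha>) times a power of x_(j+1) / x_j.
    Half of the excess \<alpha> - 1 pays for that power; the other half keeps \<theta> below
    1/2.\<close>
  define \<theta> where "\<theta> = 2 powr (- ((1 + \<alpha>) / 2))"
  have "critical_scales TYPE('a) l \<theta> \<sigma> q p x (2 powr \<alpha>) (1 + n * \<alpha>)"
  proof
    fix j
    show "0 < l j" by (rule l_pos)
    have "2 powr (- \<alpha>) * u j powr \<beta> \<le> 2 powr (- \<alpha>) * 2 powr ((\<alpha> - 1) / 2)"
      using \<beta> by (intro mult_left_mono order.trans[OF u_le N(2)]) auto
    also have "\<dots> = \<theta>"
    proof -
      have "- \<alpha> + (\<alpha> - 1) / 2 = - ((1 + \<alpha>) / 2)" by (simp add: field_simps)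
      thus ?thesis unfolding \<theta>_def powr_add[symmetric] by simp
    qed
    finally show "l (Suc j) \<le> \<theta> * l j"
      using l_pos[of j] by (simp add: l_Suc mult.commute mult_left_mono)
    show "0 < \<theta>" by (simp add: \<theta>_def)
    have "\<theta> < 2 powr (- 1)" unfolding \<theta>_def using \<alpha> by (intro powr_less_mono) auto
    thus "\<theta> < 1 / 2" by (simp add: powr_minus)
    show "1 < p" "0 < q" "q < \<sigma>" "\<sigma> * p < real DIM('a)" by fact+
    show "1 \<le> x j" by (rule x1)
    show "1 \<le> l 0" using x1[of 0] \<beta> by (simp add: l_def ge_one_powr_ge_zero)
    show "(2 ^ j) ^ DIM('a) * l j powr (real DIM('a) - \<sigma> * p) = x j powr (p - 1)"
    proof -
      have ab: "\<alpha> * (n - \<sigma> * p) = n" "\<beta> * (n - \<sigma> * p) = p - 1" using n by (auto simp: \<alpha>_def \<beta>_def)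
      have "l j powr (n - \<sigma> * p) = 2 powr (- (real j * (\<alpha> * (n - \<sigma> * p)))) * x j powr (\<beta> * (n - \<sigma> * p))"
        by (simp add: l_def powr_mult powr_powr mult_ac)
      also have "\<dots> = 2 powr (- (real j * n)) * x j powr (p - 1)" by (simp only: ab)
      finally have "l j powr (n - \<sigma> * p) = 2 powr (- (real j * n)) * x j powr (p - 1)" .
      moreover have "((2::real) ^ j) ^ DIM('a) = 2 powr (real j * n)"
        by (simp add: n_def powr_realpow[symmetric] powr_powr)
      ultimately show ?thesis by (simp add: n_def powr_minus)
    qed
    have x_powr: "x (Suc j) powr b = x j powr b * u j powr b" for b
      unfolding x_Suc by (rule powr_mult)
    show "l j powr (- (\<sigma> * p)) * x j powr (- (p - 1)) \<le> l (Suc j) powr (- (\<sigma> * p)) * x (Suc j) powr (- (p - 1))"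
    proof -
      have "u j powr (\<beta> * (\<sigma> * p) + (p - 1)) \<le> 2 powr (\<alpha> * (\<sigma> * p))"
        using \<beta> \<sigma>p0 p by (intro order.trans[OF u_le N(3)]) auto
      hence "u j powr (\<beta> * (\<sigma> * p) + (p - 1)) * u j powr (- (\<beta> * (\<sigma> * p) + (p - 1))) \<le>
          2 powr (\<alpha> * (\<sigma> * p)) * u j powr (- (\<beta> * (\<sigma> * p) + (p - 1)))"
        by (intro mult_right_mono) auto
      moreover have "u j powr (\<beta> * (\<sigma> * p) + (p - 1)) * u j powr (- (\<beta> * (\<sigma> * p) + (p - 1))) = 1"
        unfolding powr_add[symmetric] using u1[of j] by simp
      ultimately have "1 \<le> 2 powr (\<alpha> * (\<sigma> * p)) * u j powr (- (\<beta> * (\<sigma> * p) + (p - 1)))"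
        by (simp only:)
      hence "l j powr (- (\<sigma> * p)) * x j powr (- (p - 1)) * 1 \<le>
         l j powr (- (\<sigma> * p)) * x j powr (- (p - 1)) * (2 powr (\<alpha> * (\<sigma> * p)) * u j powr (- (\<beta> * (\<sigma> * p) + (p - 1))))"
        by (intro mult_left_mono) auto
      also have "u j powr (- (\<beta> * (\<sigma> * p) + (p - 1))) = u j powr (\<beta> * - (\<sigma> * p)) * u j powr (- (p - 1))"
        by (simp flip: powr_add)
      finally show ?thesis unfolding l_powr_Suc x_powr by (simp add: mult_ac)
    qed
    show "l (Suc j) powr ((\<sigma> - q) * p) * x (Suc j) powr (p - 1) \<le> l j powr ((\<sigma> - q) * p) * x j powr (p - 1)"
    proof -
      have "u j powr (\<beta> * e + (p - 1)) \<le> 2 powr (\<alpha> * e)"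
        using \<beta> e0 p by (intro order.trans[OF u_le N(4)]) auto
      hence "2 powr (- (\<alpha> * e)) * u j powr (\<beta> * e + (p - 1)) \<le> 2 powr (- (\<alpha> * e)) * 2 powr (\<alpha> * e)"
        by (intro mult_left_mono) auto
      also have "\<dots> = 1" by (simp flip: powr_add)
      finally have "l j powr e * x j powr (p - 1) * (2 powr (- (\<alpha> * e)) * u j powr (\<beta> * e + (p - 1))) \<le> l j powr e * x j powr (p - 1) * 1"
        by (intro mult_left_mono) auto
      moreover have "u j powr (\<beta> * e + (p - 1)) = u j powr (\<beta> * e) * u j powr (p - 1)" by (rule powr_add)
      ultimately show ?thesis unfolding e_def[symmetric] l_powr_Suc x_powr by (simp add: mult_ac)
    qed
    show "1 \<le> 2 powr \<alpha>" using \<alpha> by (simp add: ge_one_powr_ge_zero)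
    have "l j * 1 \<le> l j * u j powr \<beta>"
      using l_pos[of j] u1[of j] \<beta> by (intro mult_left_mono ge_one_powr_ge_zero) auto
    also have "\<dots> = 2 powr \<alpha> * l (Suc j)" by (simp add: l_Suc powr_minus)
    finally show "l j \<le> 2 powr \<alpha> * l (Suc j)" by simp
    show "0 < 1 + n * \<alpha>" using n \<alpha> by (simp add: add_pos_pos)
    show "1 - log 2 (l (Suc j) ^ DIM('a)) \<le> (1 + n * \<alpha>) * x j"
    proof -
      have "log 2 (l (Suc j) ^ DIM('a)) = n * log 2 (l (Suc j))"
        using l_pos[of "Suc j"] by (simp add: log_nat_power n_def)
      also have "log 2 (l (Suc j)) = - (\<alpha> * real (Suc j)) + \<beta> * log 2 (x (Suc j))"
        using x0[of "Suc j"] by (simp add: l_def log_mult log_powr)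
      finally have "1 - log 2 (l (Suc j) ^ DIM('a)) = 1 + n * \<alpha> * real (Suc j) - n * (\<beta> * log 2 (x (Suc j)))"
        by (simp add: algebra_simps)
      also have "\<dots> \<le> 1 + n * \<alpha> * real (Suc j)"
        using n \<beta> x1[of "Suc j"] by simp
      \<comment> \<open>Since N \<ge> 1, j + 1 \<le> x_j, which covers the index shift in
        \<open>L\<close>.\<close>
      also have "\<dots> \<le> x j + n * \<alpha> * x j"
        using x1[of j] n \<alpha> N(1) by (intro add_mono mult_left_mono) (auto simp: x_def)
      finally show ?thesis by (simp add: algebra_simps)
    qed
    show "\<not> summable (\<lambda>j. 1 / x j)"
    proof -
      have "\<not> summable (\<lambda>j. 1 / real j)"
        using not_summable_harmonic[where 'a = real] by (simp add: inverse_eq_divide)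
      thus ?thesis unfolding x_def summable_iff_shift[of "\<lambda>j. 1 / real j" N] .
    qed
  qed
  thus ?thesis by (rule that)
qed

theorem theorem5p4:
  fixes r t p p' \<tau> :: real
  assumes "r > 0" and "t \<ge> 0" and "t + r < 1" and "1 < p"
    and "p < real DIM('a::euclidean_space) / (r + t)"
    and "1 / p + 1 / p' = 1"
    and "0 \<le> \<tau>" and "\<tau> \<le> 1 / p'"
  shows "\<exists>f :: 'a \<Rightarrow> real. f \<in> M_space t \<tau> r p \<and> f \<notin> X_space t r p"
proof -
  \<comment> \<open>Any value strictly between \<open>t\<close> and \<open>t + r\<close> would
    serve; r > 0 leaves room for the midpoint.\<close>
  define q where "q = t + r / 2"
  have q_bounds: "0 < q" "q < t + r" "t < q" using assms(1,2) by (auto simp: q_def)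
  have "(t + r) * p < real DIM('a)"
    using assms(1,2,5) by (simp add: field_simps)
  from critical_scales_exist[OF assms(4) q_bounds(1,2) this]
  obtain l \<theta> x \<Theta> L where "critical_scales TYPE('a) l \<theta> (t + r) q p x \<Theta> L" .
  then interpret critical_scales l \<theta> "TYPE('a)" "t + r" q p x \<Theta> L .
  have "1 / p' = 1 - 1 / p" using assms(6) by simp
  hence "p * \<tau> \<le> p * (1 - 1 / p)" using assms(4,8) by (intro mult_left_mono) auto
  also have "\<dots> = p - 1" using assms(4) by (simp add: field_simps)
  finally show ?thesis by (intro counterexample[OF assms(2) q_bounds(3) refl])
qed

end
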